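(* For any $a\in\mathbb{C}$, let $d_a$ be the derivation on $\mathcal{M}_*^{\leq\infty}$ defined by $d_a=a\pi+w$. (i) For any $a\in\mathbb{C}$ and all quasimodular forms $f$ and $g$ of respective weights $k$ and $\ell$, we have $$\{f,g\}_1=kf\,d_a(g)-\ell g\,d_a(f).$$ (ii) More generally, for any $a\in\mathbb{C}$, the brackets defined for any integer $n\geq 0$ by (bilinear extension of) $$[f,g]_{d_a,n}=\sum_{r=0}^n(-1)^r\binom{k+n-1}{n-r}\binom{\ell+n-1}{r}d_a^r(f)\,d_a^{n-r}(g),\qquad f\in\mathcal{M}_k^{\leq\infty},\ g\in\mathcal{M}_\ell^{\leq\infty},$$ satisfy $[\mathcal{M}_k^{\leq\infty},\mathcal{M}_\ell^{\leq\infty}]_{d_a,n}\subset\mathcal{M}_{k+\ell+2n}^{\leq\infty}$ and define a formal deformation of $\mathcal{M}_*^{\leq\infty}$. (iii) Moreover, $[\mathcal{M}_k^{\leq s},\mathcal{M}_\ell^{\leq t}]_{d_a,n}\subset\mathcal{M}_{k+\ell+2n}^{\leq s+t}$ for all $n,s,t,k,\ell$ if and only if $a=0$.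
   Context: The Eisenstein series (for $\mathrm{SL}(2,\mathbb{Z})$) are $E_2=1-24\sum_{n\ge1}\sigma_1(n)q^n$, $E_4=1+240\sum_{n\ge1}\sigma_3(n)q^n$, $E_6=1-504\sum_{n\ge1}\sigma_5(n)q^n$, $q=e^{2\pi i z}$; they are algebraically independent over $\mathbb{C}$. $\mathcal{M}_*=\mathbb{C}[E_4,E_6]$ is the algebra of modular forms and $\mathcal{M}_*^{\leq\infty}=\mathbb{C}[E_2,E_4,E_6]$ the algebra of quasimodular forms, graded by the weight ($E_j$ has weight $j$). $\mathcal{M}_k$ is the space of modular forms of weight $k$ (weight-$k$ part of $\mathcal{M}_*$), $\mathcal{M}_k^{\leq\infty}$ is the space of quasimodular forms of weight $k$ (weight-$k$ part of $\mathcal{M}_*^{\leq\infty}$), and $\mathcal{M}_k^{\leq s}=\bigoplus_{j=0}^s\mathcal{M}_{k-2j}E_2^j$ is the space of quasimodular forms of weight $k$ and depth (degree in $E_2$) at most $s$; here $k,\ell\in 2\mathbb{N}$ and $s,t,n\in\mathbb{N}$. $\Delta=E_4^3-E_6^2$. $\{\cdot,\cdot\}_1$ is the Poisson bracket on $\mathcal{M}_*^{\leq\infty}$ determined by $\{E_4,E_6\}_1=-2\Delta$, $\{E_2,E_4\}_1=-\frac13(2E_6E_2-E_4^2)$, $\{E_2,E_6\}_1=-\frac12(2E_4^2E_2-E_4E_6)$. The derivation $w$ of $\mathcal{M}_*^{\leq\infty}$ is defined by $w(f)=\frac{\{\Delta,f\}_1}{12\Delta}$. A derivation $\delta$ on $\mathcal{M}_*^{\leq\infty}$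 is complex-like if $\delta(\mathcal{M}_k^{\leq s})\subset\mathcal{M}_{k+2}^{\leq s+1}$ for all $k,s$. The set of complex-like derivations $\delta$ such that $kf\delta(g)-\ell g\delta(f)=0$ for any $f\in\mathcal{M}_k^{\leq s}$, $g\in\mathcal{M}_\ell^{\leq t}$ and any $k,\ell,s,t$ is a one-dimensional complex vector space; $\pi$ denotes a (fixed) generator of it. One such generator is the linear extension of $\pi(f)=kfE_2$ for $f$ of weight $k$. A family $(\mu_n)_{n\in\mathbb{N}}$ of bilinear maps $A\times A\to A$ on a commutative $\mathbb{C}$-algebra $A$, with $\mu_0$ the product of $A$, is a formal deformation of $A$ if the product on $A[[\hslash]]$ obtained by extension of $f\ast g=\sum_{j\ge0}\mu_j(f,g)\hslash^j$ ($f,g\in A$) is associative, i.e. $\sum_{r=0}^n\mu_{n-r}(\mu_r(f,g),h)=\sum_{r=0}^n\mu_{n-r}(f,\mu_r(g,h))$ for all $f,g,h\in A$ and $n\ge0$. Binomial coefficients are $\binom{x}{m}=\frac{x(x-1)\cdots(x-m+1)}{m!}$. *)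

theory Defs
  imports "HOL-Analysis.Analysis" "HOL-Library.Function_Algebras"
begin

typedef uhp = "{z::complex. Im z > 0}"
  morphisms complex_of_uhp Abs_uhp
  by (rule exI[of _ \<i>]) simp

text \<open>Functions on the upper half plane form a commutative ring under the pointwise operations
  of \<^theory>\<open>HOL-Library.Function_Algebras\<close>, and a complex vector space under \<open>cscale\<close>.\<close>

type_synonym uhp_fun = "uhp \<Rightarrow> complex"

definition cscale :: "complex \<Rightarrow> uhp_fun \<Rightarrow> uhp_fun" where
  "cscale c f = (\<lambda>z. c * f z)"

interpretation cfun: vector_space cscale
  by unfold_locales (auto simp: cscale_def algebra_simps plus_fun_def)

definition nome :: uhp_fun where
  "nome z = exp (2 * of_real pi * \<i> * complex_of_uhp z)"

definition divisor_sum :: "nat \<Rightarrow> nat \<Rightarrow> nat" where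
  "divisor_sum k n = (\<Sum>d | d dvd n. d ^ k)"

definition eisenstein :: "complex \<Rightarrow> nat \<Rightarrow> uhp_fun" where
  "eisenstein c k z = 1 + c * (\<Sum>n. of_nat (divisor_sum k (Suc n)) * nome z ^ Suc n)"

definition E2 :: uhp_fun where "E2 = eisenstein (-24) 1"
definition E4 :: uhp_fun where "E4 = eisenstein 240 3"
definition E6 :: uhp_fun where "E6 = eisenstein (-504) 5"

definition Delta :: uhp_fun where "Delta = E4 ^ 3 - E6 ^ 2"

text \<open>Weights are natural numbers; all the weight spaces of odd weight are zero, so that
  quantifying over all weights is the same as quantifying over the even ones.\<close>

definition modular_forms :: "nat \<Rightarrow> uhp_fun set" where
  "modular_forms k = cfun.span {E4 ^ i * E6 ^ j | i j. 4 * i + 6 * j = k}"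

definition quasimodular_algebra :: "uhp_fun set" where
  "quasimodular_algebra = cfun.span {E2 ^ h * E4 ^ i * E6 ^ j | h i j. True}"

definition quasimodular_forms :: "nat \<Rightarrow> uhp_fun set" where
  "quasimodular_forms k = cfun.span {E2 ^ h * E4 ^ i * E6 ^ j | h i j. 2 * h + 4 * i + 6 * j = k}"

text \<open>The sum of the subspaces \<open>modular_forms (k - 2 * j) * E2 ^ j\<close> for \<open>j \<le> s\<close> and \<open>2 * j \<le> k\<close>.\<close>

definition quasimodular_forms_depth :: "nat \<Rightarrow> nat \<Rightarrow> uhp_fun set" where
  "quasimodular_forms_depth k s =
     cfun.span {f * E2 ^ j | f m j. j \<le> s \<and> m + 2 * j = k \<and> f \<in> modular_forms m}"

text \<open>Maps on a subalgebra \<open>A\<close> are represented by functions on the whole type whose values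
  outside \<open>A\<close> are irrelevant.\<close>

definition linear_map_on :: "uhp_fun set \<Rightarrow> (uhp_fun \<Rightarrow> uhp_fun) \<Rightarrow> bool" where
  "linear_map_on A \<delta> \<longleftrightarrow>
     (\<forall>f\<in>A. \<delta> f \<in> A) \<and>
     (\<forall>f\<in>A. \<forall>g\<in>A. \<delta> (f + g) = \<delta> f + \<delta> g) \<and>
     (\<forall>c. \<forall>f\<in>A. \<delta> (cscale c f) = cscale c (\<delta> f))"

definition bilinear_map_on :: "uhp_fun set \<Rightarrow> (uhp_fun \<Rightarrow> uhp_fun \<Rightarrow> uhp_fun) \<Rightarrow> bool" where
  "bilinear_map_on A \<beta> \<longleftrightarrow>
     (\<forall>f\<in>A. linear_map_on A (\<beta> f)) \<and> (\<forall>g\<in>A. linear_map_on A (\<lambda>f. \<beta> f g))"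

definition derivation_on :: "uhp_fun set \<Rightarrow> (uhp_fun \<Rightarrow> uhp_fun) \<Rightarrow> bool" where
  "derivation_on A \<delta> \<longleftrightarrow>
     linear_map_on A \<delta> \<and> (\<forall>f\<in>A. \<forall>g\<in>A. \<delta> (f * g) = \<delta> f * g + f * \<delta> g)"

definition poisson_bracket_on :: "uhp_fun set \<Rightarrow> (uhp_fun \<Rightarrow> uhp_fun \<Rightarrow> uhp_fun) \<Rightarrow> bool" where
  "poisson_bracket_on A P \<longleftrightarrow>
     bilinear_map_on A P \<and>
     (\<forall>f\<in>A. \<forall>g\<in>A. P f g = - P g f) \<and>
     (\<forall>f\<in>A. derivation_on A (P f)) \<and>
     (\<forall>f\<in>A. \<forall>g\<in>A. \<forall>h\<in>A. P f (P g h) + P g (P h f) + P h (P f g) = 0)"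

definition complex_like :: "(uhp_fun \<Rightarrow> uhp_fun) \<Rightarrow> bool" where
  "complex_like \<delta> \<longleftrightarrow>
     derivation_on quasimodular_algebra \<delta> \<and>
     (\<forall>k s. \<delta> ` quasimodular_forms_depth k s \<subseteq> quasimodular_forms_depth (k + 2) (s + 1))"

definition pi_derivations :: "(uhp_fun \<Rightarrow> uhp_fun) set" where
  "pi_derivations = {\<delta>. complex_like \<delta> \<and>
     (\<forall>k l s t. \<forall>f\<in>quasimodular_forms_depth k s. \<forall>g\<in>quasimodular_forms_depth l t.
        of_nat k * f * \<delta> g - of_nat l * g * \<delta> f = 0)}"

text \<open>A generator of the line \<open>pi_derivations\<close>, whose elements are identified when they agree
  on the algebra of quasimodular forms.\<close>

definition pi_generator :: "(uhp_fun \<Rightarrow> uhp_fun) \<Rightarrow> bool" where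
  "pi_generator \<delta> \<longleftrightarrow>
     \<delta> \<in> pi_derivations \<and>
     (\<exists>f\<in>quasimodular_algebra. \<delta> f \<noteq> 0) \<and>
     (\<forall>\<epsilon>\<in>pi_derivations. \<exists>c. \<forall>f\<in>quasimodular_algebra. \<epsilon> f = cscale c (\<delta> f))"

text \<open>The complex \<open>gchoose\<close> is needed because the upper argument is \<open>-1\<close> for \<open>k = n = 0\<close>.\<close>

definition rankin_cohen ::
    "(uhp_fun \<Rightarrow> uhp_fun) \<Rightarrow> nat \<Rightarrow> nat \<Rightarrow> nat \<Rightarrow> uhp_fun \<Rightarrow> uhp_fun \<Rightarrow> uhp_fun" where
  "rankin_cohen d n k l f g =
     (\<Sum>r\<le>n. cscale ((-1) ^ r * ((of_nat k + of_nat n - 1) gchoose (n - r))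
                       * ((of_nat l + of_nat n - 1) gchoose r))
        ((d ^^ r) f * (d ^^ (n - r)) g))"

text \<open>Since the homogeneous elements span the algebra, the maps \<open>\<mu> n\<close> are determined on it
  by the following property.\<close>

definition extends_rankin_cohen ::
    "(uhp_fun \<Rightarrow> uhp_fun) \<Rightarrow> (nat \<Rightarrow> uhp_fun \<Rightarrow> uhp_fun \<Rightarrow> uhp_fun) \<Rightarrow> bool" where
  "extends_rankin_cohen d \<mu> \<longleftrightarrow>
     (\<forall>n. bilinear_map_on quasimodular_algebra (\<mu> n) \<and>
       (\<forall>k l. \<forall>f\<in>quasimodular_forms k. \<forall>g\<in>quasimodular_forms l.
          \<mu> n f g = rankin_cohen d n k l f g))"

definition formal_deformation ::
    "uhp_fun set \<Rightarrow> (nat \<Rightarrow> uhp_fun \<Rightarrow> uhp_fun \<Rightarrow> uhp_fun) \<Rightarrow> bool" where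
  "formal_deformation A \<mu> \<longleftrightarrow>
     (\<forall>n. bilinear_map_on A (\<mu> n)) \<and>
     (\<forall>f\<in>A. \<forall>g\<in>A. \<mu> 0 f g = f * g) \<and>
     (\<forall>n. \<forall>f\<in>A. \<forall>g\<in>A. \<forall>h\<in>A.
        (\<Sum>r\<le>n. \<mu> (n - r) (\<mu> r f g) h) = (\<Sum>r\<le>n. \<mu> (n - r) f (\<mu> r g h)))"

end

theory Submission
  imports Defs
begin

text \<open>On the generators one computes \<open>w E4 = - E6 / 3\<close>, \<open>w E6 = - E4\<^sup>2 / 2\<close>, \<open>w E2 = - E4 / 12\<close>,
  and (i) follows because both sides are biderivations.

  Algebraic independence of \<open>E2\<close>, \<open>E4\<close>, \<open>E6\<close> is not needed in full. A generator \<open>\<pi>\<close> is necessarily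
  \<open>f \<mapsto> c k E2 f\<close> in weight \<open>k\<close>, with \<open>c \<noteq> 0\<close>; since it is defined on the whole algebra, the weight
  spaces are linearly independent. For the rest it is enough that there are no zero divisors and that
  \<open>E4\<^sup>3\<close>, \<open>E6\<^sup>2\<close> together with either \<open>E2\<^sup>2 E4\<^sup>2\<close> or \<open>E2 E4 E6\<close> are linearly independent, which is read
  off the first three coefficients of the \<open>q\<close>-expansions.

  Associativity in (ii) holds for every derivation of degree 2. Replacing the derivation acting on
  the three factors by variables \<open>x\<close>, \<open>y\<close>, \<open>z\<close>, it becomes an identity between polynomials. By Lagrange
  inversion the generating series of the bracket polynomials is
  \<open>p\<^bsup>1-k\<^esup> q\<^bsup>1-l\<^esup> / (p + q - 1)\<close> where \<open>h x = p (q - 1)\<close> and \<open>h y = (1 - p) q\<close>; in these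
  coordinates the two nested brackets are visibly equal.

  For (iii), \<open>w\<close> preserves the depth, and the coefficient of \<open>E2\<^sup>2 E4\<^sup>2\<close> in the second bracket of
  \<open>E4\<close> with itself is \<open>80 (a c)\<^sup>2\<close>.\<close>

unbundle no vec_syntax
unbundle fps_syntax

section \<open>Generating series of the Rankin-Cohen polynomials\<close>

text \<open>Because \<open>t\<close> has no constant term, \<open>t ^ i\<close> starts in degree
  \<open>i\<close> or later. The inner sum of the composition can thus be extended to the common
  bound \<open>n\<close>, and the two sums can be exchanged.\<close>

lemma fps_compose_mult_nth:
  fixes G t M :: "'a::comm_ring_1 fps"
  assumes "t $ 0 = 0"
  shows "((G oo t) * M) $ n = (\<Sum>i\<le>n. G $ i * (t ^ i * M) $ n)"
proof -
  have "((G oo t) * M) $ n = (\<Sum>j\<le>n. (\<Sum>i\<le>n. G $ i * (t ^ i) $ j) * M $ (n - j))"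
    unfolding fps_mult_nth fps_compose_nth atLeast0AtMost
  proof (rule sum.cong[OF refl])
    fix j assume "j \<in> {..n}"
    then have "(\<Sum>i\<le>j. G $ i * (t ^ i) $ j) = (\<Sum>i\<le>n. G $ i * (t ^ i) $ j)"
      by (intro sum.mono_neutral_left) (auto simp: startsby_zero_power_prefix[OF assms, rule_format])
    then show "(\<Sum>i\<le>j. G $ i * (t ^ i) $ j) * M $ (n - j)
        = (\<Sum>i\<le>n. G $ i * (t ^ i) $ j) * M $ (n - j)"
      by simp
  qed
  also have "\<dots> = (\<Sum>i\<le>n. \<Sum>j\<le>n. G $ i * ((t ^ i) $ j * M $ (n - j)))"
    by (subst sum.swap) (simp add: sum_distrib_right mult.assoc)
  finally show ?thesis
    by (simp add: sum_distrib_left fps_mult_nth atLeast0AtMost)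
qed

text \<open>If the difference \<open>D\<close> has lowest degree \<open>m\<close>, the coefficient
  of degree \<open>m\<close> in \<open>D * \<phi> ^ m\<close> is
  \<open>D $ m * (\<phi> $ 0) ^ m\<close>, which is nonzero. So the diagonal coefficients determine
  the series.\<close>

lemma fps_eqI_nth_mult_power:
  fixes K H \<phi> :: "'a::idom fps"
  assumes "\<phi> $ 0 \<noteq> 0" and "\<And>n. (K * \<phi> ^ n) $ n = (H * \<phi> ^ n) $ n"
  shows "K = H"
proof (rule ccontr)
  assume "K \<noteq> H"
  define D where "D = K - H"
  have "D \<noteq> 0" using \<open>K \<noteq> H\<close> by (simp add: D_def)
  define m where "m = subdegree D"
  have "(D * \<phi> ^ m) $ m = (\<Sum>i=0..m. D $ i * (\<phi> ^ m) $ (m - i))"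
    by (simp add: fps_mult_nth)
  also have "\<dots> = (\<Sum>i=0..m. if i = m then D $ m * (\<phi> ^ m) $ 0 else 0)"
    by (intro sum.cong) (auto simp: m_def nth_less_subdegree_zero)
  also have "\<dots> = D $ m * (\<phi> $ 0) ^ m"
    by (simp add: fps_nth_power_0)
  also have "\<dots> \<noteq> 0"
    using \<open>D \<noteq> 0\<close> assms(1) by (simp add: m_def)
  finally show False
    using assms(2)[of m] by (simp add: D_def left_diff_distrib)
qed

text \<open>Lagrange inversion in its diagonal form. By \<open>fps_eqI_nth_mult_power\<close> it
  suffices to compare diagonal coefficients, and these follow from the orthogonality relation
  \<open>orth\<close> for the powers of \<psi>.\<close>

lemma fps_lagrange:
  fixes \<phi> H :: "'a::field_char_0 fps"
  assumes \<phi>: "\<phi> $ 0 \<noteq> 0"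
  defines "\<psi> \<equiv> fps_X * inverse \<phi>"
  shows "(Abs_fps (\<lambda>n. (H * \<phi> ^ n) $ n) oo \<psi>) * fps_deriv \<psi> * \<phi> = H"
proof (rule fps_eqI_nth_mult_power[OF \<phi>])
  fix n
  define G where "G = Abs_fps (\<lambda>n. (H * \<phi> ^ n) $ n)"
  have inv: "inverse \<phi> * \<phi> = 1"
    using \<phi> by (simp add: inverse_mult_eq_1)
  have \<psi>\<phi>: "\<psi> * \<phi> = fps_X"
    by (simp add: \<psi>_def inv mult.assoc)
  have "fps_deriv (\<psi> * \<phi>) * \<phi> = \<phi>"
    by (simp add: \<psi>\<phi>)
  then have "fps_deriv \<psi> * \<phi> * \<phi> + (\<psi> * \<phi>) * fps_deriv \<phi> = \<phi>"
    by (simp only: fps_deriv_mult) (simp only: algebra_simps)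
  then have deriv: "fps_deriv \<psi> * \<phi> * \<phi> = \<phi> - fps_X * fps_deriv \<phi>"
    unfolding \<psi>\<phi> by (simp only: eq_diff_eq)
  have orth: "(\<psi> ^ i * (fps_deriv \<psi> * \<phi> * \<phi> ^ n)) $ n = (if i = n then 1 else 0)" if "i \<le> n" for i
  proof -
    define m where "m = n - i"
    have n: "n = i + m" using that by (simp add: m_def)
    have eq0: "\<psi> ^ i * (fps_deriv \<psi> * \<phi> * \<phi> ^ n) = (\<psi> * \<phi>) ^ i * (fps_deriv \<psi> * \<phi> * \<phi> ^ m)"
      by (simp only: n power_add power_mult_distrib ac_simps)
    have eq: "(\<psi> ^ i * (fps_deriv \<psi> * \<phi> * \<phi> ^ n)) $ n = (fps_deriv \<psi> * \<phi> * \<phi> ^ m) $ m"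
      unfolding eq0 \<psi>\<phi> by (simp add: n fps_X_power_mult_nth)
    show ?thesis
    proof (cases m)
      case 0
      have "fps_deriv \<psi> $ 0 = inverse (\<phi> $ 0)"
        by (simp add: \<psi>_def)
      then show ?thesis using eq 0 n \<phi> by simp
    next
      case (Suc m')
      \<comment> \<open>With \<open>F = \<phi> ^ m\<close>, multiplication by \<open>m\<close> turns
        the series into \<open>m F - X F'\<close>, and \<open>X d/dX\<close> multiplies the
        coefficient of degree \<open>m\<close> by \<open>m\<close>, so that this coefficient
        vanishes.\<close>
      have "of_nat m * (fps_deriv \<psi> * \<phi> * \<phi> ^ m)
          = of_nat m * (\<phi> ^ m' * (\<phi> - fps_X * fps_deriv \<phi>))"
        by (simp add: Suc flip: deriv)
      also have "\<dots> = of_nat m * \<phi> ^ m - fps_X * fps_deriv (\<phi> ^ m)"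
        unfolding fps_deriv_power fps_of_nat by (simp add: Suc algebra_simps)
      finally have "(of_nat m * (fps_deriv \<psi> * \<phi> * \<phi> ^ m)) $ m
          = (of_nat m * \<phi> ^ m - fps_X * fps_deriv (\<phi> ^ m)) $ m"
        by simp
      also have "\<dots> = 0"
      proof -
        have "(of_nat m * F - fps_X * fps_deriv F) $ m = 0" for F :: "'a fps"
          unfolding fps_of_nat[symmetric] using Suc by simp
        then show ?thesis .
      qed
      finally have "of_nat m * (fps_deriv \<psi> * \<phi> * \<phi> ^ m) $ m = 0"
        unfolding fps_of_nat[symmetric] by simp
      then have "(fps_deriv \<psi> * \<phi> * \<phi> ^ m) $ m = 0"
        by (simp add: Suc del: of_nat_Suc power_Suc)
      with eq have "(\<psi> ^ i * (fps_deriv \<psi> * \<phi> * \<phi> ^ n)) $ n = 0"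
        by (rule trans)
      then show ?thesis using n Suc by simp
    qed
  qed
  have "((G oo \<psi>) * fps_deriv \<psi> * \<phi> * \<phi> ^ n) $ n
      = (\<Sum>i\<le>n. G $ i * (\<psi> ^ i * (fps_deriv \<psi> * \<phi> * \<phi> ^ n)) $ n)"
    using fps_compose_mult_nth[of \<psi> G "fps_deriv \<psi> * \<phi> * \<phi> ^ n" n]
    by (simp add: \<psi>_def mult.assoc)
  also have "\<dots> = (\<Sum>i\<le>n. if i = n then G $ i else 0)"
    by (intro sum.cong) (simp_all add: orth)
  also have "\<dots> = (H * \<phi> ^ n) $ n"
    by (simp add: G_def)
  finally show "((G oo \<psi>) * fps_deriv \<psi> * \<phi> * \<phi> ^ n) $ n = (H * \<phi> ^ n) $ n" .
qed

text \<open>The symbol of the Rankin-Cohen bracket: \<open>x\<close> and \<open>y\<close> stand for the derivation acting on the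
  left and on the right factor.\<close>

definition rc_poly :: "nat \<Rightarrow> nat \<Rightarrow> nat \<Rightarrow> complex \<Rightarrow> complex \<Rightarrow> complex" where
  "rc_poly k l n x y =
     (\<Sum>r\<le>n. (-1) ^ r * ((of_nat k + of_nat n - 1) gchoose (n - r))
                * ((of_nat l + of_nat n - 1) gchoose r) * (x ^ r * y ^ (n - r)))"

lemma fps_nth_one_plus_cX_power:
  "((1 + fps_const c * fps_X) ^ N) $ r = of_nat (N choose r) * (c::complex) ^ r"
proof -
  have "(1 + fps_const c * fps_X) ^ N = (\<Sum>i\<le>N. fps_const (of_nat (N choose i) * c ^ i) * fps_X ^ i)"
    by (subst add.commute, subst binomial_ring)
       (simp add: power_mult_distrib mult.assoc flip: fps_const_mult fps_of_nat)
  also have "\<dots> $ r = (\<Sum>i\<le>N. if r = i then of_nat (N choose i) * c ^ i else 0)"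
    by (simp add: fps_sum_nth mult_delta_right)
  also have "\<dots> = of_nat (N choose r) * c ^ r"
    by (auto simp: binomial_eq_0)
  finally show ?thesis .
qed

text \<open>After reversing \<open>r\<close> to \<open>n - r\<close>, the sum is a Cauchy product of
  two binomial expansions. The bracket polynomial thereby becomes a diagonal coefficient, the input
  of Lagrange inversion.\<close>

lemma rc_poly_eq_fps_nth:
  "rc_poly k l n x y
     = ((1 + fps_const y * fps_X) ^ (k + n - 1) * (1 + fps_const (- x) * fps_X) ^ (l + n - 1)) $ n"
proof (cases n)
  \<comment> \<open>For \<open>k = 0\<close> the natural number \<open>k + n - 1\<close> is
    truncated to \<open>0\<close>, whereas the complex upper argument is \<open>-1\<close>; the
    value is \<open>1\<close> either way.\<close>
  case 0
  then show ?thesis by (simp add: rc_poly_def fps_nth_power_0)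
next
  case (Suc m)
  have *: "of_nat j + of_nat n - 1 = (of_nat (j + n - 1) :: complex)" for j
    by (simp add: Suc)
  have "rc_poly k l n x y = (\<Sum>r\<le>n. (of_nat ((k + n - 1) choose (n - r)) * y ^ (n - r))
        * (of_nat ((l + n - 1) choose r) * (- x) ^ r))"
    unfolding rc_poly_def * binomial_gbinomial[symmetric]
    by (intro sum.cong) (simp_all add: power_minus[of x])
  also have "\<dots> = (\<Sum>r\<le>n. (of_nat ((k + n - 1) choose r) * y ^ r)
        * (of_nat ((l + n - 1) choose (n - r)) * (- x) ^ (n - r)))"
    by (rule sum.reindex_bij_witness[of _ "\<lambda>r. n - r" "\<lambda>r. n - r"]) auto
  finally show ?thesis
    by (simp only: fps_mult_nth fps_nth_one_plus_cX_power atLeast0AtMost)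
qed

definition rc_fps :: "nat \<Rightarrow> nat \<Rightarrow> complex \<Rightarrow> complex \<Rightarrow> complex fps" where
  "rc_fps k l x y = Abs_fps (\<lambda>n. rc_poly k l n x y)"

text \<open>The parameters are \<open>p = 1 / (1 + y u)\<close> and \<open>q = 1 / (1 - x u)\<close>, where \<open>u\<close> solves
  \<open>u = t (1 + y u) (1 - x u)\<close>.\<close>

lemma rc_fps_compose:
  fixes p q t :: "complex fps"
  assumes p: "p $ 0 = 1" and q: "q $ 0 = 1" and t: "t $ 0 = 0"
    and x: "t * fps_const x = p * (q - 1)" and y: "t * fps_const y = (1 - p) * q"
  shows "(rc_fps k l x y oo t) * (p + q - 1) * p ^ k * q ^ l = p * q"
proof -
  define a where "a = 1 + fps_const y * fps_X"
  define b where "b = 1 + fps_const (- x) * fps_X"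
  define \<phi> where "\<phi> = a * b"
  define \<psi> where "\<psi> = fps_X * inverse \<phi>"
  \<comment> \<open>The factor \<open>inverse \<phi>\<close> supplies the \<open>-1\<close> of the
    exponents \<open>k + n - 1\<close> and \<open>l + n - 1\<close> as a division of series.\<close>
  define H where "H = a ^ k * b ^ l * inverse \<phi>"
  define u where "u = t * inverse p * inverse q"
  have ip: "inverse p * p = 1" and iq: "inverse q * q = 1"
    using p q by (simp_all add: inverse_mult_eq_1)
  have u0: "u $ 0 = 0" by (simp add: u_def t)
  have \<psi>0: "\<psi> $ 0 = 0" by (simp add: \<psi>_def)
  have \<phi>0: "\<phi> $ 0 = 1" by (simp add: \<phi>_def a_def b_def)
  have i\<phi>: "inverse \<phi> * \<phi> = 1"
    using \<phi>0 by (simp add: inverse_mult_eq_1)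
  have "rc_poly k l n x y = (H * \<phi> ^ n) $ n" for n
  proof (cases n)
    case 0
    then show ?thesis
      by (simp add: rc_poly_eq_fps_nth H_def \<phi>_def a_def b_def fps_nth_power_0)
  next
    case (Suc m)
    have "H * \<phi> ^ n = a ^ k * b ^ l * \<phi> ^ m * (inverse \<phi> * \<phi>)"
      by (simp only: H_def Suc power_Suc ac_simps)
    also have "\<dots> = a ^ (k + m) * b ^ (l + m)"
      unfolding i\<phi> by (simp only: \<phi>_def power_mult_distrib power_add mult_1_left mult_1_right ac_simps)
    finally show ?thesis
      by (simp add: rc_poly_eq_fps_nth Suc a_def b_def)
  qed
  then have "(rc_fps k l x y oo \<psi>) * fps_deriv \<psi> * \<phi> = H"
    using fps_lagrange[of \<phi> H] \<phi>0 by (simp add: rc_fps_def \<psi>_def)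
  then have "(rc_fps k l x y oo \<psi>) * (fps_deriv \<psi> * \<phi> * \<phi>) = H * \<phi>"
    by (simp add: mult.assoc)
  also have "H * \<phi> = a ^ k * b ^ l"
    by (simp add: H_def mult.assoc i\<phi>)
  also have "fps_deriv \<psi> * \<phi> * \<phi> = a + b - a * b"
  proof -
    have "\<psi> * \<phi> = fps_X" by (simp add: \<psi>_def mult.assoc i\<phi>)
    have "fps_deriv (\<psi> * \<phi>) * \<phi> = \<phi>"
      by (simp add: \<open>\<psi> * \<phi> = fps_X\<close>)
    then have "fps_deriv \<psi> * \<phi> * \<phi> + (\<psi> * \<phi>) * fps_deriv \<phi> = \<phi>"
      by (simp only: fps_deriv_mult) (simp only: algebra_simps)
    then have "fps_deriv \<psi> * \<phi> * \<phi> = \<phi> - fps_X * fps_deriv \<phi>"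
      unfolding \<open>\<psi> * \<phi> = fps_X\<close> by (simp only: eq_diff_eq)
    \<comment> \<open>As \<open>a\<close> and \<open>b\<close> are linear with constant term
      \<open>1\<close>, one has \<open>X a' = a - 1\<close> and \<open>X b' = b - 1\<close>.\<close>
    also have "\<dots> = a + b - a * b"
      by (simp add: \<phi>_def a_def b_def algebra_simps flip: fps_const_neg)
    finally show ?thesis .
  qed
  \<comment> \<open>Substituting \<open>u\<close> turns \<open>a\<close> and \<open>b\<close> into
    \<open>inverse p\<close> and \<open>inverse q\<close>, and \<psi> into \<open>t\<close>, as the
    steps below verify.\<close>
  finally have "((rc_fps k l x y oo \<psi>) * (a + b - a * b)) oo u = (a ^ k * b ^ l) oo u"
    by simp
  then have *: "(rc_fps k l x y oo (\<psi> oo u)) * ((a oo u) + (b oo u) - (a oo u) * (b oo u))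
      = (a oo u) ^ k * (b oo u) ^ l"
    by (simp add: fps_compose_mult_distrib[OF u0] fps_compose_power[OF u0, symmetric] fps_compose_add_distrib
        fps_compose_sub_distrib fps_compose_assoc[OF u0 \<psi>0])
  have "a oo u = 1 + (t * fps_const y) * inverse p * inverse q"
    using u0 by (simp add: a_def fps_compose_add_distrib fps_compose_mult_distrib) (simp add: u_def mult_ac)
  also have "\<dots> = 1 + (inverse p - inverse p * p) * (inverse q * q)"
    unfolding y by (simp only: algebra_simps mult_1_left mult_1_right)
  finally have au: "a oo u = inverse p"
    by (simp only: ip iq) simp
  have "b oo u = 1 - (t * fps_const x) * inverse p * inverse q"
    using u0 by (simp add: b_def fps_compose_sub_distrib fps_compose_mult_distrib flip: fps_const_neg)
      (simp add: u_def mult_ac)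
  also have "\<dots> = 1 - (inverse p * p) * (inverse q * q - inverse q)"
    unfolding x by (simp only: algebra_simps mult_1_left mult_1_right)
  finally have bu: "b oo u = inverse q"
    by (simp only: ip iq) simp
  have "\<psi> * \<phi> = fps_X" by (simp add: \<psi>_def mult.assoc i\<phi>)
  then have "(\<psi> oo u) * ((a oo u) * (b oo u)) = u"
    using u0 by (simp add: \<phi>_def flip: fps_compose_mult_distrib)
  then have "(\<psi> oo u) * (inverse p * inverse q) * (p * q) = u * (p * q)"
    by (simp add: au bu)
  then have "(\<psi> oo u) * (inverse p * p) * (inverse q * q) = t * (inverse p * p) * (inverse q * q)"
    by (simp add: u_def mult_ac)
  then have \<psi>u: "\<psi> oo u = t"
    by (simp add: ip iq)
  define S where "S = (rc_fps k l x y oo t)"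
  have S: "S * (inverse p + inverse q - inverse p * inverse q) = inverse p ^ k * inverse q ^ l"
    using * by (simp add: au bu \<psi>u S_def)
  have "S * (inverse p + inverse q - inverse p * inverse q) * (p * q)
      = S * ((inverse p * p) * q + (inverse q * q) * p - (inverse p * p) * (inverse q * q))"
    by (simp only: algebra_simps)
  also have "\<dots> = S * (p + q - 1)"
    unfolding ip iq by (simp add: add.commute)
  finally have "S * (p + q - 1) * p ^ k * q ^ l
      = S * (inverse p + inverse q - inverse p * inverse q) * (p * q) * (p ^ k * q ^ l)"
    by (simp only: mult.assoc)
  also have "\<dots> = (inverse p * p) ^ k * (inverse q * q) ^ l * (p * q)"
    unfolding S by (simp only: power_mult_distrib ac_simps)
  finally show ?thesis
    by (simp add: ip iq S_def)
qed

text \<open>The equation for \<open>u\<close> reads \<open>\<psi> oo u = t\<close> with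
  \<open>\<psi> = X / (a b)\<close>. As the linear coefficient of \<psi> is nonzero,
  \<open>u\<close> is its compositional inverse applied to \<open>t\<close>; then \<open>p\<close>
  and \<open>q\<close> are the reciprocals of \<open>a\<close> and \<open>b\<close> at
  \<open>u\<close>.\<close>

lemma rc_parametrisation_exists:
  fixes t :: "complex fps"
  assumes t: "t $ 0 = 0"
  obtains p q where "p $ 0 = 1" "q $ 0 = 1"
    "t * fps_const x = p * (q - 1)" "t * fps_const y = (1 - p) * q"
proof -
  define a where "a = 1 + fps_const y * fps_X"
  define b where "b = 1 + fps_const (- x) * fps_X"
  define \<psi> where "\<psi> = fps_X * inverse (a * b)"
  define u where "u = fps_inv \<psi> oo t"
  have u0: "u $ 0 = 0" by (simp add: u_def fps_inv_def)
  have \<psi>1: "\<psi> $ 0 = 0" "\<psi> $ 1 \<noteq> 0"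
    by (simp_all add: \<psi>_def a_def b_def)
  have "\<psi> oo fps_inv \<psi> = fps_X"
    using fps_inv_right[OF \<psi>1] .
  then have \<psi>u: "\<psi> oo u = t"
    unfolding u_def using t \<psi>1 by (simp add: fps_compose_assoc fps_inv_def fps_X_fps_compose_startby0)
  define p q where "p = inverse (a oo u)" and "q = inverse (b oo u)"
  have a0: "(a oo u) $ 0 = 1" and b0: "(b oo u) $ 0 = 1"
    by (simp_all add: a_def b_def)
  have ip: "p * (a oo u) = 1" and iq: "q * (b oo u) = 1"
    using a0 b0 by (simp_all add: p_def q_def inverse_mult_eq_1)
  have "inverse (a * b) * (a * b) = 1"
    by (rule inverse_mult_eq_1) (simp add: a_def b_def)
  then have "\<psi> * (a * b) = fps_X" by (simp add: \<psi>_def mult.assoc)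
  then have "(\<psi> oo u) * ((a oo u) * (b oo u)) = u"
    using u0 by (simp add: fps_X_fps_compose_startby0 flip: fps_compose_mult_distrib)
  then have "t * ((a oo u) * (b oo u)) * (p * q) = u * (p * q)"
    by (simp add: \<psi>u)
  then have "t * (p * (a oo u)) * (q * (b oo u)) = u * p * q"
    by (simp add: mult_ac)
  then have tu: "t = u * p * q"
    by (simp add: ip iq)
  have au: "a oo u = 1 + fps_const y * u" and bu: "b oo u = 1 - fps_const x * u"
    using u0 by (simp_all add: a_def b_def fps_compose_add_distrib fps_compose_mult_distrib
        fps_X_fps_compose_startby0 fps_compose_sub_distrib flip: fps_const_neg)
  have "p * fps_const y * u = 1 - p" "q * fps_const x * u = q - 1"
    using ip iq by (simp_all add: au bu algebra_simps)
  then have "t * fps_const x = p * (q - 1)" "t * fps_const y = (1 - p) * q"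
    unfolding tu by (simp_all add: mult_ac)
  moreover have "p $ 0 = 1" "q $ 0 = 1"
    using a0 b0 by (simp_all add: p_def q_def)
  ultimately show ?thesis using that by blast
qed

section \<open>Generating series of nested brackets\<close>

text \<open>Reading the coefficient of index \<open>n - r\<close> amounts to multiplying by
  \<open>X ^ r\<close>. As the series \<open>S r\<close> form a geometric progression of ratio
  \<open>v\<close>, the sum over \<open>r\<close> becomes \<open>G\<close> evaluated at
  \<open>X v\<close>.\<close>

lemma fps_shifted_series_eq_compose:
  fixes S :: "nat \<Rightarrow> 'a::field fps"
  assumes M: "M $ 0 \<noteq> 0" and S: "\<And>r. S r * M = C * v ^ r"
  shows "Abs_fps (\<lambda>n. \<Sum>r\<le>n. S r $ (n - r) * G $ r) * M = C * (G oo (fps_X * v))"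
proof -
  have M': "inverse M * M = 1" using M by (rule inverse_mult_eq_1)
  have S': "S r = v ^ r * (C * inverse M)" for r
  proof -
    have "S r = S r * M * inverse M" using M' by (metis mult.assoc mult.commute mult_1_right)
    also have "\<dots> = C * v ^ r * inverse M" by (simp only: S)
    finally show ?thesis by (simp only: ac_simps)
  qed
  have "Abs_fps (\<lambda>n. \<Sum>r\<le>n. S r $ (n - r) * G $ r) = (G oo (fps_X * v)) * (C * inverse M)"
  proof (rule fps_ext)
    fix n
    have "((G oo (fps_X * v)) * (C * inverse M)) $ n
        = (\<Sum>r\<le>n. G $ r * ((fps_X * v) ^ r * (C * inverse M)) $ n)"
      by (rule fps_compose_mult_nth) simp
    also have "\<dots> = (\<Sum>r\<le>n. S r $ (n - r) * G $ r)"
      unfolding S' by (intro sum.cong) (auto simp: power_mult_distrib mult.assoc fps_X_power_mult_nth)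
    finally show "Abs_fps (\<lambda>n. \<Sum>r\<le>n. S r $ (n - r) * G $ r) $ n
        = ((G oo (fps_X * v)) * (C * inverse M)) $ n" by simp
  qed
  then show ?thesis
    by (simp add: mult.assoc M')
qed

text \<open>An inner bracket of order \<open>r\<close> raises the weight of the left argument by
  \<open>2 * r\<close>, and by \<open>rc_fps_compose\<close> this divides the outer series by
  \<open>P ^ (2 * r)\<close>. The outer series thus form a geometric progression in
  \<open>r\<close>.\<close>

lemma rc_fps_nested_left:
  fixes P Q :: "complex fps"
  assumes P: "P $ 0 = 1" and Q: "Q $ 0 = 1"
    and x: "fps_X * fps_const x = P * (Q - 1)" and z: "fps_X * fps_const z = (1 - P) * Q"
  shows "Abs_fps (\<lambda>n. \<Sum>r\<le>n. rc_poly (k + 2 * r) m (n - r) x z * G $ r)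
           * ((P + Q - 1) * P ^ k * Q ^ m)
         = P * Q * (G oo (fps_X * inverse P ^ 2))"
proof -
  have iP: "inverse P * P = 1" using P by (simp add: inverse_mult_eq_1)
  have "rc_fps (k + 2 * r) m x z * ((P + Q - 1) * P ^ k * Q ^ m) = P * Q * (inverse P ^ 2) ^ r" for r
  proof -
    have *: "rc_fps (k + 2 * r) m x z * (P + Q - 1) * P ^ (k + 2 * r) * Q ^ m = P * Q"
      using rc_fps_compose[OF P Q _ x z, of "k + 2 * r" m] by simp
    have "rc_fps (k + 2 * r) m x z * ((P + Q - 1) * P ^ k * Q ^ m)
        = rc_fps (k + 2 * r) m x z * ((P + Q - 1) * P ^ k * Q ^ m) * (inverse P * P) ^ (2 * r)"
      by (simp add: iP)
    also have "\<dots> = (rc_fps (k + 2 * r) m x z * (P + Q - 1) * P ^ (k + 2 * r) * Q ^ m) * (inverse P ^ 2) ^ r"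
      by (simp only: power_mult[symmetric] power_mult_distrib power_add ac_simps)
    finally show ?thesis unfolding * .
  qed
  from fps_shifted_series_eq_compose[OF _ this, of G] show ?thesis
    using P Q by (simp add: rc_fps_def fps_nth_power_0)
qed

text \<open>Mirror image of \<open>rc_fps_nested_left\<close>: the inner bracket sits in the right
  argument, so the ratio is \<open>inverse Q ^ 2\<close>.\<close>

lemma rc_fps_nested_right:
  fixes P Q :: "complex fps"
  assumes P: "P $ 0 = 1" and Q: "Q $ 0 = 1"
    and x: "fps_X * fps_const x = P * (Q - 1)" and z: "fps_X * fps_const z = (1 - P) * Q"
  shows "Abs_fps (\<lambda>n. \<Sum>r\<le>n. rc_poly k (m + 2 * r) (n - r) x z * G $ r)
           * ((P + Q - 1) * P ^ k * Q ^ m)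
         = P * Q * (G oo (fps_X * inverse Q ^ 2))"
proof -
  have iQ: "inverse Q * Q = 1" using Q by (simp add: inverse_mult_eq_1)
  have "rc_fps k (m + 2 * r) x z * ((P + Q - 1) * P ^ k * Q ^ m) = P * Q * (inverse Q ^ 2) ^ r" for r
  proof -
    have *: "rc_fps k (m + 2 * r) x z * (P + Q - 1) * P ^ k * Q ^ (m + 2 * r) = P * Q"
      using rc_fps_compose[OF P Q _ x z, of k "m + 2 * r"] by simp
    have "rc_fps k (m + 2 * r) x z * ((P + Q - 1) * P ^ k * Q ^ m)
        = rc_fps k (m + 2 * r) x z * ((P + Q - 1) * P ^ k * Q ^ m) * (inverse Q * Q) ^ (2 * r)"
      by (simp add: iQ)
    also have "\<dots> = (rc_fps k (m + 2 * r) x z * (P + Q - 1) * P ^ k * Q ^ (m + 2 * r)) * (inverse Q ^ 2) ^ r"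
      by (simp only: power_mult[symmetric] power_mult_distrib power_add ac_simps)
    finally show ?thesis unfolding * .
  qed
  from fps_shifted_series_eq_compose[OF _ this, of G] show ?thesis
    using P Q by (simp add: rc_fps_def fps_nth_power_0)
qed

text \<open>If \<open>(P, \<gamma>)\<close> and \<open>(p, q)\<close> are the parameters of the outer and of the inner series on the left, then
  with \<open>\<alpha> = P p\<close>, \<open>\<beta> = P q\<close>, \<open>T = 1 + \<beta> - P\<close> the parameters on the right are \<open>(\<alpha>, T)\<close> and
  \<open>(\<beta> / T, \<gamma> / T)\<close>.\<close>

proposition rc_poly_assoc:
  "(\<Sum>r\<le>n. rc_poly (k + l + 2 * r) m (n - r) (x + y) z * rc_poly k l r x y)
   = (\<Sum>r\<le>n. rc_poly k (l + m + 2 * r) (n - r) x (y + z) * rc_poly l m r y z)"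
proof -
  obtain P \<gamma> where P0: "P $ 0 = 1" and \<gamma>0: "\<gamma> $ 0 = 1"
    and xy: "fps_X * fps_const (x + y) = P * (\<gamma> - 1)" and z: "fps_X * fps_const z = (1 - P) * \<gamma>"
    using rc_parametrisation_exists[of fps_X "x + y" z] by auto
  have iP: "inverse P * P = 1" using P0 by (simp add: inverse_mult_eq_1)
  obtain p q where p0: "p $ 0 = 1" and q0: "q $ 0 = 1"
    and px: "fps_X * inverse P ^ 2 * fps_const x = p * (q - 1)"
    and py: "fps_X * inverse P ^ 2 * fps_const y = (1 - p) * q"
    using rc_parametrisation_exists[of "fps_X * inverse P ^ 2" x y] by auto
  define \<alpha> where "\<alpha> = P * p"
  define \<beta> where "\<beta> = P * q"
  define T where "T = 1 + \<beta> - P"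
  have \<alpha>0: "\<alpha> $ 0 = 1" and \<beta>0: "\<beta> $ 0 = 1" and T0: "T $ 0 = 1"
    using P0 p0 q0 by (simp_all add: \<alpha>_def \<beta>_def T_def)
  have iT: "inverse T * T = 1" using T0 by (simp add: inverse_mult_eq_1)
  have cancelP: "fps_X * w = fps_X * inverse P ^ 2 * w * P ^ 2" for w
  proof -
    have "fps_X * inverse P ^ 2 * w * P ^ 2 = fps_X * w * (inverse P * P) ^ 2"
      by (simp only: power_mult_distrib ac_simps)
    then show ?thesis by (simp add: iP)
  qed
  have \<alpha>x: "fps_X * fps_const x = \<alpha> * (\<beta> - P)"
    unfolding cancelP[of "fps_const x", unfolded px] by (simp only: \<alpha>_def \<beta>_def power2_eq_square algebra_simps mult_1_left mult_1_right)
  have \<alpha>y: "fps_X * fps_const y = (P - \<alpha>) * \<beta>"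
    unfolding cancelP[of "fps_const y", unfolded py] by (simp only: \<alpha>_def \<beta>_def power2_eq_square algebra_simps mult_1_left mult_1_right)
  \<comment> \<open>Adding the equations for \<open>x\<close> and \<open>y\<close> must reproduce
    the one for \<open>x + y\<close>; cancelling \<open>P\<close> then expresses \<gamma> by
    \<alpha> and \<beta>.\<close>
  have "P * (\<gamma> - 1) = \<alpha> * (\<beta> - P) + (P - \<alpha>) * \<beta>"
    unfolding xy[symmetric] \<alpha>x[symmetric] \<alpha>y[symmetric] by (simp add: algebra_simps flip: fps_const_add)
  also have "\<dots> = P * (\<beta> - \<alpha>)"
    by (simp add: algebra_simps)
  finally have "\<gamma> - 1 = \<beta> - \<alpha>"
    using P0 by auto
  then have \<gamma>: "\<gamma> = 1 + \<beta> - \<alpha>"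
    by (simp add: algebra_simps)
  have rx: "fps_X * fps_const x = \<alpha> * (T - 1)"
    by (simp add: \<alpha>x T_def)
  have ryz: "fps_X * fps_const (y + z) = (1 - \<alpha>) * T"
  proof -
    have "fps_X * fps_const (y + z) = (P - \<alpha>) * \<beta> + (1 - P) * \<gamma>"
      unfolding \<alpha>y[symmetric] z[symmetric] by (simp add: algebra_simps flip: fps_const_add)
    then show ?thesis by (simp add: \<gamma> T_def algebra_simps)
  qed
  define p' where "p' = \<beta> * inverse T"
  define q' where "q' = \<gamma> * inverse T"
  have p'0: "p' $ 0 = 1" and q'0: "q' $ 0 = 1"
    using \<beta>0 \<gamma>0 T0 by (simp_all add: p'_def q'_def)
  have Tp': "T * p' = \<beta>" and Tq': "T * q' = \<gamma>"
    using iT by (simp_all add: p'_def q'_def mult_ac)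
  have cancelT: "w = w * T ^ 2 * inverse T ^ 2" for w
  proof -
    have "w * T ^ 2 * inverse T ^ 2 = w * (inverse T * T) ^ 2"
      by (simp only: power_mult_distrib ac_simps)
    then show ?thesis by (simp add: iT)
  qed
  have p'y: "fps_X * inverse T ^ 2 * fps_const y = p' * (q' - 1)"
  proof -
    have "p' * (q' - 1) * T ^ 2 = (T * p') * (T * q' - T)"
      by (simp add: power2_eq_square algebra_simps)
    also have "\<dots> = fps_X * fps_const y"
      unfolding Tp' Tq' \<alpha>y by (simp add: \<gamma> T_def algebra_simps)
    finally show ?thesis
      using cancelT[of "p' * (q' - 1)"] by (simp add: mult_ac)
  qed
  have p'z: "fps_X * inverse T ^ 2 * fps_const z = (1 - p') * q'"
  proof -
    have "(1 - p') * q' * T ^ 2 = (T - T * p') * (T * q')"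
      by (simp add: power2_eq_square algebra_simps)
    also have "\<dots> = fps_X * fps_const z"
      unfolding Tp' Tq' z by (simp add: T_def algebra_simps)
    finally show ?thesis
      using cancelT[of "(1 - p') * q'"] by (simp add: mult_ac)
  qed
  define L where "L = Abs_fps (\<lambda>n. \<Sum>r\<le>n. rc_poly (k + l + 2 * r) m (n - r) (x + y) z * rc_poly k l r x y)"
  define R where "R = Abs_fps (\<lambda>n. \<Sum>r\<le>n. rc_poly k (l + m + 2 * r) (n - r) x (y + z) * rc_poly l m r y z)"
  \<comment> \<open>The common denominator of both sides. Its first two factors exchange roles: the
    outer factor on the left is the rescaled inner factor \<open>T * p' + T * q' - T\<close> on the
    right, and the outer factor \<open>\<alpha> + T - 1\<close> on the right is the rescaled inner
    factor on the left.\<close>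
  define N where "N = (P + \<gamma> - 1) * (\<alpha> + \<beta> - P) * \<alpha> ^ k * \<beta> ^ l * \<gamma> ^ m"
  have "L * N = \<alpha> * \<beta> * \<gamma>"
  proof -
    define S where "S = (rc_fps k l x y oo (fps_X * inverse P ^ 2))"
    have 1: "L * ((P + \<gamma> - 1) * P ^ (k + l) * \<gamma> ^ m) = P * \<gamma> * S"
      using rc_fps_nested_left[OF P0 \<gamma>0 xy z, of "k + l" m "rc_fps k l x y"]
      by (simp add: L_def S_def rc_fps_def)
    have 2: "S * (p + q - 1) * p ^ k * q ^ l = p * q"
      unfolding S_def by (rule rc_fps_compose[OF p0 q0 _ px py]) simp
    have "L * N = (L * ((P + \<gamma> - 1) * P ^ (k + l) * \<gamma> ^ m)) * (P * p + P * q - P) * p ^ k * q ^ l"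
      unfolding N_def \<alpha>_def \<beta>_def by (simp only: power_mult_distrib power_add ac_simps)
    also have "\<dots> = P * P * \<gamma> * (S * (p + q - 1) * p ^ k * q ^ l)"
      unfolding 1 by (simp add: algebra_simps)
    finally show ?thesis
      unfolding 2 by (simp add: \<alpha>_def \<beta>_def mult_ac)
  qed
  moreover have "R * N = \<alpha> * \<beta> * \<gamma>"
  proof -
    define S where "S = (rc_fps l m y z oo (fps_X * inverse T ^ 2))"
    have 1: "R * ((\<alpha> + T - 1) * \<alpha> ^ k * T ^ (l + m)) = \<alpha> * T * S"
      using rc_fps_nested_right[OF \<alpha>0 T0 rx ryz, of k "l + m" "rc_fps l m y z"]
      by (simp add: R_def S_def rc_fps_def)
    have 2: "S * (p' + q' - 1) * p' ^ l * q' ^ m = p' * q'"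
      unfolding S_def by (rule rc_fps_compose[OF p'0 q'0 _ p'y p'z]) simp
    have N': "N = (T * p' + T * q' - T) * (\<alpha> + T - 1) * \<alpha> ^ k * (T * p') ^ l * (T * q') ^ m"
      unfolding Tp' Tq' N_def by (simp add: T_def algebra_simps)
    have "R * N = (R * ((\<alpha> + T - 1) * \<alpha> ^ k * T ^ (l + m))) * (T * p' + T * q' - T) * p' ^ l * q' ^ m"
      unfolding N' by (simp only: power_mult_distrib power_add ac_simps)
    also have "\<dots> = \<alpha> * T * T * (S * (p' + q' - 1) * p' ^ l * q' ^ m)"
      unfolding 1 by (simp add: algebra_simps)
    finally show ?thesis
      unfolding 2 Tp'[symmetric] Tq'[symmetric] by (simp add: mult_ac)
  qed
  moreover have "N \<noteq> 0"
  proof -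
    have "N $ 0 = 1" using P0 \<alpha>0 \<beta>0 \<gamma>0 by (simp add: N_def fps_nth_power_0)
    then show ?thesis by auto
  qed
  ultimately have "L = R"
    by (metis mult_right_cancel)
  then have "L $ n = R $ n" by simp
  then show ?thesis by (simp add: L_def R_def)
qed

section \<open>Linear extension from monomials in three variables\<close>

lemma trivariate_polyfun_eq_0:
  assumes "\<And>x y z :: complex. (\<Sum>a\<le>N. \<Sum>b\<le>N. \<Sum>c\<le>N. u a b c * (x ^ a * y ^ b * z ^ c)) = 0"
    and "a \<le> N" "b \<le> N" "c \<le> N"
  shows "u a b c = 0"
proof -
  have "(\<Sum>a\<le>N. (\<Sum>b\<le>N. (\<Sum>c\<le>N. u a b c * z ^ c) * y ^ b) * x ^ a) = 0" for x y z
    using assms(1)[where x = x and y = y and z = z] by (simp add: sum_distrib_left sum_distrib_right mult_ac)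
  then have "(\<Sum>b\<le>N. (\<Sum>c\<le>N. u a b c * z ^ c) * y ^ b) = 0" for y z
    using \<open>a \<le> N\<close> polyfun_eq_0[of "\<lambda>a. \<Sum>b\<le>N. (\<Sum>c\<le>N. u a b c * z ^ c) * y ^ b" N] by blast
  then have "(\<Sum>c\<le>N. u a b c * z ^ c) = 0" for z
    using \<open>b \<le> N\<close> polyfun_eq_0[of "\<lambda>b. \<Sum>c\<le>N. u a b c * z ^ c" N] by blast
  then show ?thesis
    using \<open>c \<le> N\<close> polyfun_eq_0[of "u a b" N] by blast
qed

text \<open>Monomials are linearly independent as functions on complex triples, so arbitrary values
  on them extend linearly to all functions. This converts polynomial identities into identities
  between iterated derivations.\<close>

lemma monomials_linear_extension:
  obtains \<Phi> :: "(complex \<times> complex \<times> complex \<Rightarrow> complex) \<Rightarrow> uhp_fun"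
  where "\<And>f g. \<Phi> (\<lambda>t. f t + g t) = \<Phi> f + \<Phi> g" "\<And>c f. \<Phi> (\<lambda>t. c * f t) = cscale c (\<Phi> f)"
    "\<And>a b c. \<Phi> (\<lambda>(x, y, z). x ^ a * y ^ b * z ^ c) = v a b c"
proof -
  define sc :: "complex \<Rightarrow> (complex \<times> complex \<times> complex \<Rightarrow> complex) \<Rightarrow> complex \<times> complex \<times> complex \<Rightarrow> complex"
    where "sc = (\<lambda>c f t. c * f t)"
  interpret L: vector_space sc
    by unfold_locales (auto simp: sc_def fun_eq_iff algebra_simps)
  interpret LP: vector_space_pair sc cscale ..
  define mon :: "nat \<times> nat \<times> nat \<Rightarrow> complex \<times> complex \<times> complex \<Rightarrow> complex"
    where "mon = (\<lambda>(a, b, c) (x, y, z). x ^ a * y ^ b * z ^ c)"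
  have inj: "inj mon"
  proof (rule injI)
    fix i j assume eq: "mon i = mon j"
    obtain a b c a' b' c' where ij: "i = (a, b, c)" "j = (a', b', c')"
      by (metis prod.exhaust)
    \<comment> \<open>A \<open>2\<close> in one coordinate and \<open>1\<close> in the others
      isolates one exponent.\<close>
    have "mon i (2, 1, 1) = mon j (2, 1, 1)" "mon i (1, 2, 1) = mon j (1, 2, 1)"
      "mon i (1, 1, 2) = mon j (1, 1, 2)"
      by (simp_all add: eq)
    then have "(2::complex) ^ a = 2 ^ a'" "(2::complex) ^ b = 2 ^ b'" "(2::complex) ^ c = 2 ^ c'"
      by (simp_all add: mon_def ij)
    then have "norm ((2::complex) ^ a) = norm ((2::complex) ^ a')" "norm ((2::complex) ^ b) = norm ((2::complex) ^ b')"
       "norm ((2::complex) ^ c) = norm ((2::complex) ^ c')"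
      by simp_all
    then show "i = j" by (simp add: ij norm_power)
  qed
  have "L.independent (range mon)"
    unfolding L.independent_explicit_module
  proof (intro allI impI)
    fix T u f assume T: "finite T" "T \<subseteq> range mon" and sum: "(\<Sum>f\<in>T. sc (u f) f) = 0" and f: "f \<in> T"
    define I where "I = mon -` T"
    have I: "finite I" unfolding I_def using T(1) inj by (rule finite_vimageI)
    have TI: "T = mon ` I" using T(2) by (auto simp: I_def)
    \<comment> \<open>\<open>N\<close> bounds every exponent occurring in \<open>I\<close>, so the
      sum can be padded with zero coefficients to the full box required by
      \<open>trivariate_polyfun_eq_0\<close>.\<close>
    define N where "N = Max ((\<lambda>(a, b, c). a + b + c) ` I)"
    have N: "a + b + c \<le> N" if "(a, b, c) \<in> I" for a b c
      unfolding N_def using I that by (intro Max_ge) (auto intro: rev_image_eqI)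
    define u' where "u' = (\<lambda>a b c. if (a, b, c) \<in> I then u (mon (a, b, c)) else 0)"
    have zero: "(\<Sum>a\<le>N. \<Sum>b\<le>N. \<Sum>c\<le>N. u' a b c * (x ^ a * y ^ b * z ^ c)) = 0" for x y z
    proof -
      have "0 = (\<Sum>f\<in>T. sc (u f) f) (x, y, z)" by (simp add: sum)
      also have "\<dots> = (\<Sum>f\<in>T. u f * f (x, y, z))"
        by (induction T rule: infinite_finite_induct) (auto simp: sc_def)
      also have "\<dots> = (\<Sum>i\<in>I. u (mon i) * mon i (x, y, z))"
        unfolding TI by (subst sum.reindex) (auto intro: inj_on_subset[OF inj])
      also have "\<dots> = (\<Sum>i\<in>{..N} \<times> {..N} \<times> {..N}. if i \<in> I then u (mon i) * mon i (x, y, z) else 0)"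
      proof (subst sum.inter_restrict[symmetric])
        have "I \<subseteq> {..N} \<times> {..N} \<times> {..N}" using N by force
        then show "(\<Sum>i\<in>I. u (mon i) * mon i (x, y, z))
           = (\<Sum>i\<in>({..N} \<times> {..N} \<times> {..N}) \<inter> I. u (mon i) * mon i (x, y, z))"
          by (simp add: Int_absorb1)
      qed auto
      also have "\<dots> = (\<Sum>i\<in>{..N} \<times> {..N} \<times> {..N}. case i of (a, b, c) \<Rightarrow> u' a b c * (x ^ a * y ^ b * z ^ c))"
        by (intro sum.cong) (auto simp: u'_def mon_def)
      finally show ?thesis
        by (simp add: sum.cartesian_product)
    qed
    obtain a b c where abc: "f = mon (a, b, c)" "(a, b, c) \<in> I"
      using f TI by auto
    from N[OF abc(2)] have "u' a b c = 0"
      by (intro trivariate_polyfun_eq_0[OF zero]) auto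
    then show "u f = 0" by (simp add: u'_def abc)
  qed
  from LP.linear_independent_extend[OF this, of "(\<lambda>(a, b, c). v a b c) \<circ> inv mon"]
  obtain \<Phi> where lin: "Vector_Spaces.linear sc cscale \<Phi>"
    and \<Phi>: "\<And>f. f \<in> range mon \<Longrightarrow> \<Phi> f = ((\<lambda>(a, b, c). v a b c) \<circ> inv mon) f"
    by blast
  interpret \<Phi>: Vector_Spaces.linear sc cscale \<Phi> by fact
  show ?thesis
  proof (rule that)
    show "\<Phi> (\<lambda>t. f t + g t) = \<Phi> f + \<Phi> g" for f g
      using \<Phi>.add[of f g] by (simp add: plus_fun_def)
    show "\<Phi> (\<lambda>t. c * f t) = cscale c (\<Phi> f)" for c f
      using \<Phi>.scale[of c f] by (simp add: sc_def)
    show "\<Phi> (\<lambda>(x, y, z). x ^ a * y ^ b * z ^ c) = v a b c" for a b c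
      using \<Phi>[of "mon (a, b, c)"] by (simp add: inv_f_f[OF inj]) (simp add: mon_def)
  qed
qed

section \<open>Associativity of Rankin-Cohen brackets\<close>

lemma cscale_simps:
  "cscale a f * g = cscale a (f * g)" "cscale a (cscale b f) = cscale (a * b) f"
  "f * cscale a g = cscale a (f * g)" "cscale a (f + g) = cscale a f + cscale a g"
  by (auto simp: cscale_def fun_eq_iff algebra_simps)

lemma cscale_sum: "cscale a (sum f I) = (\<Sum>i\<in>I. cscale a (f i))"
  by (rule cfun.scale_sum_right)

locale uhp_subalgebra =
  fixes A :: "uhp_fun set"
  assumes subspace: "cfun.subspace A" and mult_closed: "f \<in> A \<Longrightarrow> g \<in> A \<Longrightarrow> f * g \<in> A"
begin

lemma add_closed: "f \<in> A \<Longrightarrow> g \<in> A \<Longrightarrow> f + g \<in> A"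
  using subspace by (rule cfun.subspace_add)

lemma cscale_closed: "f \<in> A \<Longrightarrow> cscale c f \<in> A"
  using subspace by (rule cfun.subspace_scale)

lemma sum_closed: "(\<And>i. i \<in> I \<Longrightarrow> f i \<in> A) \<Longrightarrow> sum f I \<in> A"
  using subspace by (rule cfun.subspace_sum)

end

locale uhp_derivation = uhp_subalgebra +
  fixes D :: "uhp_fun \<Rightarrow> uhp_fun"
  assumes derivation: "derivation_on A D"
begin

lemma D_closed: "f \<in> A \<Longrightarrow> D f \<in> A"
  and D_add: "f \<in> A \<Longrightarrow> g \<in> A \<Longrightarrow> D (f + g) = D f + D g"
  and D_cscale: "f \<in> A \<Longrightarrow> D (cscale c f) = cscale c (D f)"
  and D_mult: "f \<in> A \<Longrightarrow> g \<in> A \<Longrightarrow> D (f * g) = D f * g + f * D g"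
  using derivation by (auto simp: derivation_on_def linear_map_on_def)

lemma Dpow_closed: "f \<in> A \<Longrightarrow> (D ^^ n) f \<in> A"
  by (induction n) (auto intro: D_closed)

lemma Dpow_add: "f \<in> A \<Longrightarrow> g \<in> A \<Longrightarrow> (D ^^ n) (f + g) = (D ^^ n) f + (D ^^ n) g"
  by (induction n) (auto simp: D_add Dpow_closed)

lemma Dpow_cscale: "f \<in> A \<Longrightarrow> (D ^^ n) (cscale c f) = cscale c ((D ^^ n) f)"
  by (induction n) (auto simp: D_cscale Dpow_closed)

lemma Dpow_sum:
  "finite I \<Longrightarrow> (\<And>i. i \<in> I \<Longrightarrow> f i \<in> A) \<Longrightarrow> (D ^^ n) (sum f I) = (\<Sum>i\<in>I. (D ^^ n) (f i))"
proof (induction I rule: finite_induct)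
  case empty
  have "(D ^^ n) (cscale 0 0) = cscale 0 ((D ^^ n) 0)"
    by (intro Dpow_cscale cfun.subspace_0 subspace)
  then show ?case by (simp only: sum.empty cfun.scale_zero_left)
next
  case (insert i I)
  then show ?case
    by (simp only: sum.insert insert_iff Dpow_add sum_closed simp_thms)
qed

lemma rankin_cohen_closed: "f \<in> A \<Longrightarrow> g \<in> A \<Longrightarrow> rankin_cohen D n k l f g \<in> A"
  unfolding rankin_cohen_def by (intro sum_closed cscale_closed mult_closed Dpow_closed)

text \<open>A linear map \<open>\<Phi>\<close> sending \<open>x\<^sup>a y\<^sup>b z\<^sup>c\<close> to \<open>D\<^sup>a f D\<^sup>b g D\<^sup>c h\<close> turns multiplication by \<open>x + y\<close>
  into \<open>D\<close> applied to the product of the first two factors.\<close>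

lemma rankin_cohen_assoc:
  assumes f: "f \<in> A" and g: "g \<in> A" and h: "h \<in> A"
  shows "(\<Sum>r\<le>n. rankin_cohen D (n - r) (k + l + 2 * r) m (rankin_cohen D r k l f g) h)
       = (\<Sum>r\<le>n. rankin_cohen D (n - r) k (l + m + 2 * r) f (rankin_cohen D r l m g h))"
proof -
  obtain \<Phi> :: "(complex \<times> complex \<times> complex \<Rightarrow> complex) \<Rightarrow> uhp_fun"
    where \<Phi>_add: "\<And>p q. \<Phi> (\<lambda>t. p t + q t) = \<Phi> p + \<Phi> q"
      and \<Phi>_scale: "\<And>c p. \<Phi> (\<lambda>t. c * p t) = cscale c (\<Phi> p)"
      and \<Phi>_mon: "\<And>a b c. \<Phi> (\<lambda>(x, y, z). x ^ a * y ^ b * z ^ c) = (D ^^ a) f * (D ^^ b) g * (D ^^ c) h"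
    using monomials_linear_extension[of "\<lambda>a b c. (D ^^ a) f * (D ^^ b) g * (D ^^ c) h"] by blast
  have \<Phi>_sum: "\<Phi> (\<lambda>t. \<Sum>i\<in>I. p i t) = (\<Sum>i\<in>I. \<Phi> (p i))" if "finite I" for I :: "nat set" and p
    using that
  proof (induction I rule: finite_induct)
    case empty
    show ?case using \<Phi>_scale[of 0 "\<lambda>_. 0"] by (simp add: cscale_def zero_fun_def)
  next
    case (insert i I)
    then show ?case by (simp add: \<Phi>_add)
  qed
  \<comment> \<open>Induction on \<open>j\<close>: splitting off one factor \<open>x + y\<close>
    raises \<open>a\<close> or \<open>b\<close> by one, just as the Leibniz rule does.\<close>
  have left: "\<Phi> (\<lambda>(x, y, z). (x + y) ^ j * (x ^ a * y ^ b) * z ^ c)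
      = (D ^^ j) ((D ^^ a) f * (D ^^ b) g) * (D ^^ c) h" for j a b c
  proof (induction j arbitrary: a b)
    case 0
    then show ?case by (simp add: \<Phi>_mon)
  next
    case (Suc j)
    have "(\<lambda>(x, y, z). (x + y) ^ Suc j * (x ^ a * y ^ b) * z ^ c)
       = (\<lambda>t::complex \<times> complex \<times> complex. (case t of (x, y, z) \<Rightarrow> (x + y) ^ j * (x ^ Suc a * y ^ b) * z ^ c)
           + (case t of (x, y, z) \<Rightarrow> (x + y) ^ j * (x ^ a * y ^ Suc b) * z ^ c))"
      by (auto simp: fun_eq_iff algebra_simps)
    moreover have "(D ^^ Suc j) ((D ^^ a) f * (D ^^ b) g)
       = (D ^^ j) ((D ^^ Suc a) f * (D ^^ b) g) + (D ^^ j) ((D ^^ a) f * (D ^^ Suc b) g)"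
      unfolding funpow_Suc_right comp_def using f g
      by (subst D_mult) (auto intro!: Dpow_closed D_closed mult_closed Dpow_add simp flip: funpow_swap1)
    ultimately show ?case
      by (simp only: \<Phi>_add Suc.IH distrib_right)
  qed
  have right: "\<Phi> (\<lambda>(x, y, z). x ^ c * ((y + z) ^ j * (y ^ a * z ^ b)))
      = (D ^^ c) f * (D ^^ j) ((D ^^ a) g * (D ^^ b) h)" for j a b c
  proof (induction j arbitrary: a b)
    case 0
    then show ?case using \<Phi>_mon[of c a b] by (simp add: mult.assoc)
  next
    case (Suc j)
    have "(\<lambda>(x, y, z). x ^ c * ((y + z) ^ Suc j * (y ^ a * z ^ b)))
       = (\<lambda>t::complex \<times> complex \<times> complex. (case t of (x, y, z) \<Rightarrow> x ^ c * ((y + z) ^ j * (y ^ Suc a * z ^ b)))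
           + (case t of (x, y, z) \<Rightarrow> x ^ c * ((y + z) ^ j * (y ^ a * z ^ Suc b))))"
      by (auto simp: fun_eq_iff algebra_simps)
    moreover have "(D ^^ Suc j) ((D ^^ a) g * (D ^^ b) h)
       = (D ^^ j) ((D ^^ Suc a) g * (D ^^ b) h) + (D ^^ j) ((D ^^ a) g * (D ^^ Suc b) h)"
      unfolding funpow_Suc_right comp_def using g h
      by (subst D_mult) (auto intro!: Dpow_closed D_closed mult_closed Dpow_add simp flip: funpow_swap1)
    ultimately show ?case
      by (simp only: \<Phi>_add Suc.IH distrib_left)
  qed
  define C where "C = (\<lambda>k l n r. (-1) ^ r * ((of_nat k + of_nat n - 1) gchoose (n - r))
     * ((of_nat l + of_nat n - 1 :: complex) gchoose r))" for k l n r :: nat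
  have "rankin_cohen D s K m (rankin_cohen D r k l f g) h
       = \<Phi> (\<lambda>(x, y, z). rc_poly K m s (x + y) z * rc_poly k l r x y)" for K s r
  proof -
    have "(\<lambda>(x, y, z). rc_poly K m s (x + y) z * rc_poly k l r x y)
       = (\<lambda>t. \<Sum>j\<le>s. \<Sum>i\<le>r. (C K m s j * C k l r i) *
            (case t of (x, y, z) \<Rightarrow> (x + y) ^ j * (x ^ i * y ^ (r - i)) * z ^ (s - j)))"
      by (auto simp: fun_eq_iff rc_poly_def C_def sum_product intro!: sum.cong)
    then have "\<Phi> (\<lambda>(x, y, z). rc_poly K m s (x + y) z * rc_poly k l r x y)
       = (\<Sum>j\<le>s. \<Sum>i\<le>r. cscale (C K m s j * C k l r i)
            ((D ^^ j) ((D ^^ i) f * (D ^^ (r - i)) g) * (D ^^ (s - j)) h))"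
      by (simp only: \<Phi>_sum[OF finite_atMost] \<Phi>_scale left)
    also have "\<dots> = (\<Sum>j\<le>s. cscale (C K m s j)
            ((D ^^ j) (\<Sum>i\<le>r. cscale (C k l r i) ((D ^^ i) f * (D ^^ (r - i)) g)) * (D ^^ (s - j)) h))"
      using f g by (simp add: Dpow_sum Dpow_cscale cscale_closed mult_closed Dpow_closed
          sum_distrib_right cscale_sum cscale_simps)
    finally show ?thesis
      by (simp add: rankin_cohen_def C_def)
  qed
  moreover have "rankin_cohen D s k K f (rankin_cohen D r l m g h)
       = \<Phi> (\<lambda>(x, y, z). rc_poly k K s x (y + z) * rc_poly l m r y z)" for K s r
  proof -
    have "(\<lambda>(x, y, z). rc_poly k K s x (y + z) * rc_poly l m r y z)
       = (\<lambda>t. \<Sum>j\<le>s. \<Sum>i\<le>r. (C k K s j * C l m r i) *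
            (case t of (x, y, z) \<Rightarrow> x ^ j * ((y + z) ^ (s - j) * (y ^ i * z ^ (r - i)))))"
      by (auto simp: fun_eq_iff rc_poly_def C_def sum_product intro!: sum.cong)
    then have "\<Phi> (\<lambda>(x, y, z). rc_poly k K s x (y + z) * rc_poly l m r y z)
       = (\<Sum>j\<le>s. \<Sum>i\<le>r. cscale (C k K s j * C l m r i)
            ((D ^^ j) f * (D ^^ (s - j)) ((D ^^ i) g * (D ^^ (r - i)) h)))"
      by (simp only: \<Phi>_sum[OF finite_atMost] \<Phi>_scale right)
    also have "\<dots> = (\<Sum>j\<le>s. cscale (C k K s j)
            ((D ^^ j) f * (D ^^ (s - j)) (\<Sum>i\<le>r. cscale (C l m r i) ((D ^^ i) g * (D ^^ (r - i)) h))))"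
      using g h by (simp add: Dpow_sum Dpow_cscale cscale_closed mult_closed Dpow_closed
          sum_distrib_left cscale_sum cscale_simps)
    finally show ?thesis
      by (simp add: rankin_cohen_def C_def)
  qed
  \<comment> \<open>The polynomial identity enters here: the two sums of symbols agree as functions
    before \<Phi> is applied.\<close>
  moreover have "\<Phi> (\<lambda>t. \<Sum>r\<le>n. case t of (x, y, z) \<Rightarrow> rc_poly (k + l + 2 * r) m (n - r) (x + y) z * rc_poly k l r x y)
      = \<Phi> (\<lambda>t. \<Sum>r\<le>n. case t of (x, y, z) \<Rightarrow> rc_poly k (l + m + 2 * r) (n - r) x (y + z) * rc_poly l m r y z)"
    by (intro arg_cong[where f = \<Phi>]) (auto simp: fun_eq_iff rc_poly_assoc)
  ultimately show ?thesis
    by (simp only: \<Phi>_sum[OF finite_atMost])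
qed

end

section \<open>Expansions at the cusp\<close>

text \<open>The radius condition guarantees convergence at every value of the nome, since these
  values lie in the open unit disc.\<close>

definition has_qexp :: "uhp_fun \<Rightarrow> complex fps \<Rightarrow> bool" where
  "has_qexp f F \<longleftrightarrow> 1 \<le> fps_conv_radius F \<and> f = (\<lambda>z. eval_fps F (nome z))"

lemma norm_nome_less_1: "norm (nome z) < 1"
  using complex_of_uhp[of z] by (simp add: nome_def)

lemma nome_surj:
  assumes "q \<noteq> 0" "norm q < 1"
  obtains z where "nome z = q"
proof
  define w where "w = Ln q / (2 * of_real pi * \<i>)"
  have "w = - \<i> * Ln q / of_real (2 * pi)"
    by (simp add: w_def field_simps)
  then have "Im w = - ln (norm q) / (2 * pi)"
    using assms by (simp only: Im_divide_of_real) (simp add: Re_Ln)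
  also have "\<dots> > 0"
    using assms by (intro divide_pos_pos) auto
  finally have "complex_of_uhp (Abs_uhp w) = w"
    by (intro Abs_uhp_inverse) simp
  then show "nome (Abs_uhp w) = q"
    using assms by (simp add: nome_def w_def)
qed

lemma norm_nome_less_radius: "1 \<le> fps_conv_radius F \<Longrightarrow> ereal (norm (nome z)) < fps_conv_radius F"
  using norm_nome_less_1[of z] by (metis ereal_less(3) less_le_trans one_ereal_def)

lemma has_qexp_0: "has_qexp 0 0"
  by (simp add: has_qexp_def zero_fun_def)

lemma has_qexp_1: "has_qexp 1 1"
  by (simp add: has_qexp_def one_fun_def)

lemma has_qexp_add:
  assumes "has_qexp f F" "has_qexp g G"
  shows "has_qexp (f + g) (F + G)"
proof -
  have "1 \<le> fps_conv_radius (F + G)"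
    using assms fps_conv_radius_add[of F G] by (auto simp: has_qexp_def elim: order_trans[rotated])
  then show ?thesis
    using assms by (auto simp: has_qexp_def plus_fun_def norm_nome_less_radius eval_fps_add)
qed

lemma has_qexp_mult:
  assumes "has_qexp f F" "has_qexp g G"
  shows "has_qexp (f * g) (F * G)"
proof -
  have "1 \<le> fps_conv_radius (F * G)"
    using assms fps_conv_radius_mult[of F G] by (auto simp: has_qexp_def elim: order_trans[rotated])
  then show ?thesis
    using assms by (auto simp: has_qexp_def times_fun_def norm_nome_less_radius eval_fps_mult)
qed

lemma has_qexp_cscale: "has_qexp f F \<Longrightarrow> has_qexp (cscale c f) (fps_const c * F)"
  using has_qexp_mult[of "\<lambda>_. c" "fps_const c" f F]
  by (simp add: has_qexp_def cscale_def times_fun_def)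

lemma has_qexp_power: "has_qexp f F \<Longrightarrow> has_qexp (f ^ n) (F ^ n)"
  by (induction n) (auto intro: has_qexp_1 has_qexp_mult)

lemma has_qexp_0_imp_0:
  assumes "has_qexp 0 F"
  shows "F = 0"
proof -
  have F: "1 \<le> fps_conv_radius F" and zero: "\<And>z. eval_fps F (nome z) = 0"
    using assms by (auto simp: has_qexp_def fun_eq_iff)
  \<comment> \<open>The nome never equals \<open>0\<close>, so \<open>F\<close> is known to vanish
    on the punctured disc only. The factor \<open>fps_X\<close> adds the missing zero at the
    centre.\<close>
  have X: "1 \<le> fps_conv_radius (fps_X * F)"
    using F fps_conv_radius_mult[of fps_X F] by (auto elim: order_trans[rotated])
  have "eval_fps (fps_X * F) q = 0" if "norm q < 1" for q
  proof -
    have "ereal (norm q) < fps_conv_radius F"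
      using that F by (metis ereal_less(3) less_le_trans one_ereal_def)
    then have "eval_fps (fps_X * F) q = q * eval_fps F q"
      by (simp add: eval_fps_mult)
    then show ?thesis using that zero by (metis mult_eq_0_iff nome_surj)
  qed
  moreover have "eventually (\<lambda>q::complex. norm q < 1) (nhds 0)"
    using eventually_nhds_in_open[of "ball 0 1" "0::complex"] by (simp add: dist_norm)
  ultimately have "eventually (\<lambda>q. eval_fps (fps_X * F) q = eval_fps 0 q) (nhds 0)"
    by (auto elim: eventually_mono)
  moreover have "0 < fps_conv_radius (fps_X * F)"
    by (rule less_le_trans[OF _ X]) simp
  ultimately have "fps_X * F = 0"
    by (intro eval_fps_eqD) auto
  then show ?thesis by simp
qed

lemma has_qexp_unique_0: "has_qexp f F \<Longrightarrow> f = 0 \<longleftrightarrow> F = 0"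
  using has_qexp_0_imp_0 has_qexp_0 by (auto simp: has_qexp_def zero_fun_def)

text \<open>Inherited from formal power series, which form an integral domain. Every later
  cancellation of \<open>E2\<close>, \<open>E4\<close> or \<open>Delta\<close> rests on
  this.\<close>

lemma has_qexp_mult_eq_0:
  assumes "has_qexp f F" "has_qexp g G" "f * g = 0"
  shows "f = 0 \<or> g = 0"
  using has_qexp_unique_0 has_qexp_mult assms by (metis mult_eq_0_iff)

section \<open>Expansions of the Eisenstein series\<close>

text \<open>Starting from the geometric series, \<open>X d/dX\<close> raises the exponent
  \<open>k\<close> by one and does not shrink the radius.\<close>

lemma fps_conv_radius_nat_power: "1 \<le> fps_conv_radius (Abs_fps (\<lambda>n. of_nat n ^ k :: complex))"
proof (induction k)
  case 0
  show ?case
    unfolding fps_conv_radius_def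
    by (rule conv_radius_geI_ex') (simp add: summable_geometric norm_of_real)
next
  case (Suc k)
  define F where "F = Abs_fps (\<lambda>n. of_nat n ^ k :: complex)"
  have "Abs_fps (\<lambda>n. of_nat n ^ Suc k :: complex) = fps_X * fps_deriv F"
    by (rule fps_ext) (auto simp: F_def)
  moreover have "min (fps_conv_radius (fps_X :: complex fps)) (fps_conv_radius (fps_deriv F)) \<le> fps_conv_radius (fps_X * fps_deriv F)"
    by (rule fps_conv_radius_mult)
  moreover have "1 \<le> fps_conv_radius (fps_deriv F)"
    using Suc.IH fps_conv_radius_deriv[of F] by (simp add: F_def)
  ultimately show ?case by (auto elim: order_trans)
qed

lemma divisor_sum_le: "divisor_sum k n \<le> n ^ (k + 1)"
proof (cases "n = 0")
  case True
  then show ?thesis by (simp add: divisor_sum_def)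
next
  case False
  have "divisor_sum k n \<le> (\<Sum>d | d dvd n. n ^ k)"
    unfolding divisor_sum_def using False by (intro sum_mono power_mono) (auto dest: dvd_imp_le)
  also have "\<dots> = card {d. d dvd n} * n ^ k" by simp
  also have "card {d. d dvd n} \<le> card {1..n}"
    using False by (intro card_mono) (auto dest: dvd_imp_le intro: Suc_leI dvd_pos_nat)
  finally show ?thesis by simp
qed

definition eisenstein_fps :: "complex \<Rightarrow> nat \<Rightarrow> complex fps" where
  "eisenstein_fps c k = Abs_fps (\<lambda>n. if n = 0 then 1 else c * of_nat (divisor_sum k n))"

lemma has_qexp_eisenstein: "has_qexp (eisenstein c k) (eisenstein_fps c k)"
proof -
  have *: "1 \<le> fps_conv_radius (Abs_fps (\<lambda>n. of_nat (divisor_sum k n) :: complex))"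
    unfolding fps_conv_radius_def
  proof (rule conv_radius_geI_ex')
    fix r :: real assume r: "0 < r" "ereal r < 1"
    have "summable (\<lambda>n. norm (of_nat n ^ (k + 1) * of_real r ^ n :: complex))"
      using norm_summable_fps[of "of_real r" "Abs_fps (\<lambda>n. of_nat n ^ (k + 1) :: complex)"] r
        less_le_trans[OF r(2) fps_conv_radius_nat_power[of "k + 1"]] by simp
    then show "summable (\<lambda>n. Abs_fps (\<lambda>n. of_nat (divisor_sum k n) :: complex) $ n * of_real r ^ n)"
    proof (rule summable_comparison_test[rotated], intro exI allI impI)
      fix n :: nat
      have "real (divisor_sum k n) \<le> real n ^ (k + 1)"
        using divisor_sum_le[of k n] by (metis of_nat_le_iff of_nat_power)
      then show "norm (Abs_fps (\<lambda>n. of_nat (divisor_sum k n) :: complex) $ n * of_real r ^ n)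
          \<le> norm (of_nat n ^ (k + 1) * of_real r ^ n :: complex)"
        using r(1) by (simp add: norm_mult norm_power mult_right_mono)
    qed
  qed
  define S where "S = Abs_fps (\<lambda>n. of_nat (divisor_sum k n) :: complex)"
  have S: "(\<lambda>n. of_nat (divisor_sum k n) * nome z ^ n) sums eval_fps S (nome z)" for z
    using sums_eval_fps[of "nome z" S] * by (simp add: S_def norm_nome_less_radius)
  \<comment> \<open>Every number divides \<open>0\<close>, and a sum over an infinite set is
    \<open>0\<close> by convention. Hence \<open>S\<close> has no constant term, and starting at
    \<open>Suc n\<close> in \<open>eisenstein\<close> loses nothing.\<close>
  have d0: "divisor_sum k 0 = 0" by (simp add: divisor_sum_def)
  have E: "eisenstein c k = 1 + cscale c (\<lambda>z. eval_fps S (nome z))"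
  proof
    fix z
    show "eisenstein c k z = (1 + cscale c (\<lambda>z. eval_fps S (nome z))) z"
      using S[of z] sums_Suc_iff[of "\<lambda>n. of_nat (divisor_sum k n) * nome z ^ n" "eval_fps S (nome z)"]
      by (simp add: eisenstein_def d0 cscale_def sums_iff)
  qed
  have "eisenstein_fps c k = 1 + fps_const c * S"
    by (rule fps_ext) (auto simp: eisenstein_fps_def S_def d0)
  moreover have "has_qexp (\<lambda>z. eval_fps S (nome z)) S"
    using * by (simp add: has_qexp_def S_def)
  ultimately show ?thesis
    unfolding E by (auto intro: has_qexp_add has_qexp_1 has_qexp_cscale)
qed

lemma quasimodular_algebra_has_qexp:
  assumes "f \<in> quasimodular_algebra"
  shows "\<exists>F. has_qexp f F"
  using assms unfolding quasimodular_algebra_def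
proof (induction rule: cfun.span_induct_alt)
  case base
  then show ?case using has_qexp_0 by blast
next
  case (step c x y)
  then show ?case
    unfolding E2_def E4_def E6_def
    by (blast intro: has_qexp_add has_qexp_cscale has_qexp_mult has_qexp_power has_qexp_eisenstein)
qed

lemma quasimodular_algebra_mult_eq_0:
  "f \<in> quasimodular_algebra \<Longrightarrow> g \<in> quasimodular_algebra \<Longrightarrow> f * g = 0 \<Longrightarrow> f = 0 \<or> g = 0"
  by (meson has_qexp_mult_eq_0 quasimodular_algebra_has_qexp)

lemma quasimodular_algebra_mult_left_cancel:
  assumes "h \<in> quasimodular_algebra" "f \<in> quasimodular_algebra" "g \<in> quasimodular_algebra"
    "h \<noteq> 0" "h * f = h * g"
  shows "f = g"
proof -
  have "f - g \<in> quasimodular_algebra"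
    using assms unfolding quasimodular_algebra_def by (intro cfun.span_diff)
  moreover have "h * (f - g) = 0" using assms by (simp add: right_diff_distrib)
  ultimately show ?thesis using assms quasimodular_algebra_mult_eq_0[of h "f - g"] by auto
qed

lemma fps_mult_nth_2: "(f * g) $ 2 = f $ 0 * g $ 2 + f $ 1 * g $ 1 + f $ 2 * g $ 0"
  by (simp add: fps_mult_nth eval_nat_numeral)

lemma eisenstein_fps_nth:
  "eisenstein_fps c k $ 0 = 1" "eisenstein_fps c k $ Suc 0 = c" "eisenstein_fps c k $ 2 = c * (1 + 2 ^ k)"
proof -
  have "{d::nat. d dvd 2} = {1, 2}"
    using two_is_prime_nat by (auto simp: prime_nat_iff)
  then show "eisenstein_fps c k $ 0 = 1" "eisenstein_fps c k $ Suc 0 = c" "eisenstein_fps c k $ 2 = c * (1 + 2 ^ k)"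
    by (simp_all add: eisenstein_fps_def divisor_sum_def)
qed

text \<open>The coefficients of index \<open>0\<close>, \<open>1\<close>, \<open>2\<close> give a
  linear system with nonzero determinant. The first relation yields \<open>Delta_neq_0\<close> and
  the test of the depth, the second determines the shape of \<pi>.\<close>

lemma weight_12_relations:
  shows "cscale a (E2 ^ 2 * E4 ^ 2) + cscale b (E4 ^ 3) + cscale c (E6 ^ 2) = 0 \<Longrightarrow> a = 0 \<and> b = 0 \<and> c = 0"
    and "cscale a (E2 * E4 * E6) + cscale b (E4 ^ 3) + cscale c (E6 ^ 2) = 0 \<Longrightarrow> a = 0 \<and> b = 0 \<and> c = 0"
proof -
  define F2 F4 F6 where F: "F2 = eisenstein_fps (-24) 1" "F4 = eisenstein_fps 240 3" "F6 = eisenstein_fps (-504) 5"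
  have E: "has_qexp E2 F2" "has_qexp E4 F4" "has_qexp E6 F6"
    unfolding E2_def E4_def E6_def F by (rule has_qexp_eisenstein)+
  note nth = F eisenstein_fps_nth fps_mult_nth_2 power2_eq_square power3_eq_cube
  show "a = 0 \<and> b = 0 \<and> c = 0" if "cscale a (E2 ^ 2 * E4 ^ 2) + cscale b (E4 ^ 3) + cscale c (E6 ^ 2) = 0"
  proof -
    define H where "H = fps_const a * (F2 ^ 2 * F4 ^ 2) + fps_const b * F4 ^ 3 + fps_const c * F6 ^ 2"
    have "has_qexp 0 H"
      unfolding that[symmetric] H_def
      by (intro has_qexp_add has_qexp_cscale has_qexp_mult has_qexp_power E)
    then have "H = 0" by (rule has_qexp_0_imp_0)
    then have "H $ 0 = 0" "H $ Suc 0 = 0" "H $ 2 = 0" by simp_all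
    then have "a + b + c = 0" "432 * a + 720 * b - 1008 * c = 0" "39312 * a + 179280 * b + 220752 * c = 0"
      by (simp_all add: H_def nth algebra_simps)
    then show ?thesis by algebra
  qed
  show "a = 0 \<and> b = 0 \<and> c = 0" if "cscale a (E2 * E4 * E6) + cscale b (E4 ^ 3) + cscale c (E6 ^ 2) = 0"
  proof -
    define H where "H = fps_const a * (F2 * F4 * F6) + fps_const b * F4 ^ 3 + fps_const c * F6 ^ 2"
    have "has_qexp 0 H"
      unfolding that[symmetric] H_def
      by (intro has_qexp_add has_qexp_cscale has_qexp_mult has_qexp_power E)
    then have "H = 0" by (rule has_qexp_0_imp_0)
    then have "H $ 0 = 0" "H $ Suc 0 = 0" "H $ 2 = 0" by simp_all
    then have "a + b + c = 0" "- 288 * a + 720 * b - 1008 * c = 0" "- 129168 * a + 179280 * b + 220752 * c = 0"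
      by (simp_all add: H_def nth algebra_simps)
    then show ?thesis by algebra
  qed
qed

lemma eisenstein_neq_0: "eisenstein c k \<noteq> 0"
proof
  assume "eisenstein c k = 0"
  then have "eisenstein_fps c k = 0"
    using has_qexp_unique_0[OF has_qexp_eisenstein] by blast
  then show False
    using eisenstein_fps_nth(1)[of c k] by simp
qed

section \<open>Weight, depth and derivations\<close>

lemma power_fun_apply: "(f ^ n) x = (f x :: 'a::monoid_mult) ^ n"
  by (induction n) (simp_all)

lemmas uhp_fun_simps = fun_eq_iff cscale_def power_fun_apply numeral_fun_apply of_nat_fun_apply

text \<open>Flattens the nested spans, so that statements about the depth can be checked on
  monomials in the generators.\<close>

lemma quasimodular_forms_depth_altdef:
  "quasimodular_forms_depth k s
     = cfun.span {E2 ^ h * E4 ^ i * E6 ^ j | h i j. h \<le> s \<and> 2 * h + 4 * i + 6 * j = k}"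
  (is "?L = cfun.span ?G")
proof (rule antisym)
  have "f * E2 ^ h \<in> cfun.span ?G" if "h \<le> s" "m + 2 * h = k" "f \<in> modular_forms m" for f h m
  proof -
    have "cfun.span {E4 ^ i * E6 ^ j | i j. 4 * i + 6 * j = m} \<subseteq> {f. f * E2 ^ h \<in> cfun.span ?G}"
    proof (rule cfun.span_minimal)
      show "{E4 ^ i * E6 ^ j | i j. 4 * i + 6 * j = m} \<subseteq> {f. f * E2 ^ h \<in> cfun.span ?G}"
      proof clarify
        fix i j assume "m = 4 * i + 6 * j"
        then have "E2 ^ h * E4 ^ i * E6 ^ j \<in> cfun.span ?G"
          using that(1,2) by (intro cfun.span_base CollectI exI[of _ h] exI[of _ i] exI[of _ j]) auto
        then show "E4 ^ i * E6 ^ j * E2 ^ h \<in> cfun.span ?G"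
          by (simp add: mult_ac)
      qed
    qed (rule cfun.subspaceI, auto simp: distrib_right cscale_simps
        intro: cfun.span_zero cfun.span_add cfun.span_scale)
    then show ?thesis
      using that(3) by (auto simp: modular_forms_def)
  qed
  then show "?L \<subseteq> cfun.span ?G"
    unfolding quasimodular_forms_depth_def by (intro cfun.span_minimal) auto
next
  show "cfun.span ?G \<subseteq> ?L"
    unfolding quasimodular_forms_depth_def
  proof (intro cfun.span_mono subsetI)
    fix f assume "f \<in> ?G"
    then obtain h i j where f: "f = E2 ^ h * E4 ^ i * E6 ^ j" "h \<le> s" "2 * h + 4 * i + 6 * j = k"
      by blast
    have "E4 ^ i * E6 ^ j \<in> modular_forms (4 * i + 6 * j)"
      unfolding modular_forms_def by (intro cfun.span_base) blast
    moreover have "f = (E4 ^ i * E6 ^ j) * E2 ^ h" "4 * i + 6 * j + 2 * h = k"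
      using f by (simp_all add: mult_ac)
    ultimately show "f \<in> {f * E2 ^ j |f m j. j \<le> s \<and> m + 2 * j = k \<and> f \<in> modular_forms m}"
      using f(2) by blast
  qed
qed

text \<open>A monomial of weight \<open>k\<close> has degree at most \<open>k\<close> in
  \<open>E2\<close>, so this bound excludes nothing. Statements about weights become instances of
  statements about depths.\<close>

lemma quasimodular_forms_eq_depth: "quasimodular_forms k = quasimodular_forms_depth k k"
  unfolding quasimodular_forms_def quasimodular_forms_depth_altdef
  by (rule arg_cong[where f = cfun.span]) fastforce

lemma quasimodular_forms_depth_mono: "s \<le> t \<Longrightarrow> quasimodular_forms_depth k s \<subseteq> quasimodular_forms_depth k t"
  unfolding quasimodular_forms_depth_altdef by (intro cfun.span_mono) fastforce

lemma quasimodular_forms_depth_subset: "quasimodular_forms_depth k s \<subseteq> quasimodular_forms k"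
  unfolding quasimodular_forms_depth_altdef quasimodular_forms_def by (intro cfun.span_mono) fastforce

lemma quasimodular_forms_subset_algebra: "quasimodular_forms k \<subseteq> quasimodular_algebra"
  unfolding quasimodular_algebra_def quasimodular_forms_def by (intro cfun.span_mono) fastforce

lemma quasimodular_forms_in_algebra: "f \<in> quasimodular_forms k \<Longrightarrow> f \<in> quasimodular_algebra"
  using quasimodular_forms_subset_algebra by blast

lemma quasimodular_forms_depth_in_algebra: "f \<in> quasimodular_forms_depth k s \<Longrightarrow> f \<in> quasimodular_algebra"
  using quasimodular_forms_depth_subset quasimodular_forms_subset_algebra by blast

lemma subspace_quasimodular_forms: "cfun.subspace (quasimodular_forms k)"
  unfolding quasimodular_forms_def by (rule cfun.subspace_span)

lemma subspace_quasimodular_forms_depth: "cfun.subspace (quasimodular_forms_depth k s)"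
  unfolding quasimodular_forms_depth_def by (rule cfun.subspace_span)

lemma subspace_quasimodular_algebra: "cfun.subspace quasimodular_algebra"
  unfolding quasimodular_algebra_def by (rule cfun.subspace_span)

lemma span_mult_closed:
  assumes "\<And>f g. f \<in> F \<Longrightarrow> g \<in> G \<Longrightarrow> f * g \<in> cfun.span H"
    and "f \<in> cfun.span F" "g \<in> cfun.span G"
  shows "f * g \<in> cfun.span H"
proof -
  note closed = cfun.span_zero cfun.span_add cfun.span_scale
  have "cfun.span G \<subseteq> {g. f * g \<in> cfun.span H}" if "f \<in> F" for f
    using that assms(1)
    by (intro cfun.span_minimal cfun.subspaceI) (auto simp: distrib_left cscale_simps intro: closed)
  then have "cfun.span F \<subseteq> {f. f * g \<in> cfun.span H}"
    using assms(3)
    by (intro cfun.span_minimal cfun.subspaceI) (auto simp: distrib_right cscale_simps intro: closed)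
  then show ?thesis using assms(2) by blast
qed

lemma monomial_mult:
  "(E2 ^ h * E4 ^ i * E6 ^ j) * (E2 ^ h' * E4 ^ i' * E6 ^ j') = E2 ^ (h + h') * E4 ^ (i + i') * E6 ^ (j + j')"
  by (simp add: power_add mult_ac)

lemma quasimodular_forms_depth_mult:
  assumes "f \<in> quasimodular_forms_depth k s" "g \<in> quasimodular_forms_depth l t"
  shows "f * g \<in> quasimodular_forms_depth (k + l) (s + t)"
proof -
  define G where "G k s = {E2 ^ h * E4 ^ i * E6 ^ j | h i j. h \<le> s \<and> 2 * h + 4 * i + 6 * j = k}" for k s
  have eq: "quasimodular_forms_depth k s = cfun.span (G k s)" for k s
    by (simp add: quasimodular_forms_depth_altdef G_def)
  have "u * v \<in> cfun.span (G (k + l) (s + t))" if "u \<in> G k s" "v \<in> G l t" for u v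
  proof -
    from that obtain h i j h' i' j'
      where "u = E2 ^ h * E4 ^ i * E6 ^ j" "h \<le> s" "2 * h + 4 * i + 6 * j = k"
        "v = E2 ^ h' * E4 ^ i' * E6 ^ j'" "h' \<le> t" "2 * h' + 4 * i' + 6 * j' = l"
      unfolding G_def by blast
    then show ?thesis
      unfolding G_def
      by (intro cfun.span_base CollectI exI[of _ "h + h'"] exI[of _ "i + i'"] exI[of _ "j + j'"])
        (auto simp: monomial_mult)
  qed
  then show ?thesis
    using assms unfolding eq by (rule span_mult_closed)
qed

lemma quasimodular_forms_mult:
  "f \<in> quasimodular_forms k \<Longrightarrow> g \<in> quasimodular_forms l \<Longrightarrow> f * g \<in> quasimodular_forms (k + l)"
  unfolding quasimodular_forms_eq_depth by (rule quasimodular_forms_depth_mult)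

lemma quasimodular_algebra_mult:
  assumes "f \<in> quasimodular_algebra" "g \<in> quasimodular_algebra"
  shows "f * g \<in> quasimodular_algebra"
  using _ assms unfolding quasimodular_algebra_def
proof (rule span_mult_closed)
  fix u v assume "u \<in> {E2 ^ h * E4 ^ i * E6 ^ j |h i j. True}" "v \<in> {E2 ^ h * E4 ^ i * E6 ^ j |h i j. True}"
  then obtain h i j h' i' j' where "u = E2 ^ h * E4 ^ i * E6 ^ j" "v = E2 ^ h' * E4 ^ i' * E6 ^ j'"
    by blast
  then show "u * v \<in> cfun.span {E2 ^ h * E4 ^ i * E6 ^ j |h i j. True}"
    using monomial_mult by (intro cfun.span_base) blast
qed

interpretation qm: uhp_subalgebra quasimodular_algebra
  by unfold_locales (auto intro: quasimodular_algebra_mult simp: quasimodular_algebra_def[symmetric] subspace_quasimodular_algebra)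

lemma one_in_depth: "1 \<in> quasimodular_forms_depth 0 0"
  and E2_in_depth: "E2 \<in> quasimodular_forms_depth 2 1"
  and E4_in_depth: "E4 \<in> quasimodular_forms_depth 4 0"
  and E6_in_depth: "E6 \<in> quasimodular_forms_depth 6 0"
proof -
  have *: "E2 ^ h * E4 ^ i * E6 ^ j \<in> quasimodular_forms_depth (2 * h + 4 * i + 6 * j) h" for h i j
    unfolding quasimodular_forms_depth_altdef by (intro cfun.span_base) blast
  show "1 \<in> quasimodular_forms_depth 0 0" using *[of 0 0 0] by simp
  show "E2 \<in> quasimodular_forms_depth 2 1" using *[of 1 0 0] by simp
  show "E4 \<in> quasimodular_forms_depth 4 0" using *[of 0 1 0] by simp
  show "E6 \<in> quasimodular_forms_depth 6 0" using *[of 0 0 1] by simp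
qed

lemmas generators_in_algebra =
  one_in_depth[THEN quasimodular_forms_depth_in_algebra] E2_in_depth[THEN quasimodular_forms_depth_in_algebra]
  E4_in_depth[THEN quasimodular_forms_depth_in_algebra] E6_in_depth[THEN quasimodular_forms_depth_in_algebra]

lemma quasimodular_algebra_power: "f \<in> quasimodular_algebra \<Longrightarrow> f ^ n \<in> quasimodular_algebra"
  by (induction n) (auto intro: qm.mult_closed generators_in_algebra)

lemma Delta_in_algebra: "Delta \<in> quasimodular_algebra"
  unfolding Delta_def
  by (intro cfun.subspace_diff[OF qm.subspace] quasimodular_algebra_power generators_in_algebra)

lemma Delta_neq_0: "Delta \<noteq> 0"
proof
  assume "Delta = 0"
  then have "cscale 0 (E2 ^ 2 * E4 ^ 2) + cscale 1 (E4 ^ 3) + cscale (-1) (E6 ^ 2) = 0"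
    by (simp add: Delta_def uhp_fun_simps)
  then show False using weight_12_relations(1) by fastforce
qed

lemma quasimodular_algebra_induct [consumes 1, case_names zero add cscale homogeneous]:
  assumes "f \<in> quasimodular_algebra" and "Q 0"
    and "\<And>f g. f \<in> quasimodular_algebra \<Longrightarrow> g \<in> quasimodular_algebra \<Longrightarrow> Q f \<Longrightarrow> Q g \<Longrightarrow> Q (f + g)"
    and "\<And>c f. f \<in> quasimodular_algebra \<Longrightarrow> Q f \<Longrightarrow> Q (cscale c f)"
    and "\<And>k f. f \<in> quasimodular_forms k \<Longrightarrow> Q f"
  shows "Q f"
proof -
  have "quasimodular_algebra \<subseteq> {f. f \<in> quasimodular_algebra \<and> Q f}" (is "_ \<subseteq> ?S")
    unfolding quasimodular_algebra_def
  proof (rule cfun.span_minimal, fold quasimodular_algebra_def)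
    show "{E2 ^ h * E4 ^ i * E6 ^ j |h i j. True} \<subseteq> ?S"
    proof clarify
      fix h i j
      have "E2 ^ h * E4 ^ i * E6 ^ j \<in> quasimodular_forms (2 * h + 4 * i + 6 * j)"
        unfolding quasimodular_forms_def by (intro cfun.span_base) blast
      then show "E2 ^ h * E4 ^ i * E6 ^ j \<in> quasimodular_algebra \<and> Q (E2 ^ h * E4 ^ i * E6 ^ j)"
        using assms(5) quasimodular_forms_in_algebra by blast
    qed
    show "cfun.subspace ?S"
      using assms(2-4) cfun.subspace_0[OF qm.subspace]
      by (intro cfun.subspaceI) (auto intro: qm.add_closed qm.cscale_closed)
  qed
  then show ?thesis using assms(1) by blast
qed

text \<open>The term of index \<open>r\<close> has weight
  \<open>(k + 2 * r) + (l + 2 * (n - r))\<close>. The families are abstract so that they can be the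
  full weight spaces as well as those of fixed depth.\<close>

lemma rankin_cohen_homogeneous:
  assumes "\<And>k f. f \<in> U k \<Longrightarrow> D f \<in> U (k + 2)" "\<And>k f. f \<in> V k \<Longrightarrow> D f \<in> V (k + 2)"
    and "\<And>k l f g. f \<in> U k \<Longrightarrow> g \<in> V l \<Longrightarrow> f * g \<in> W (k + l)"
    and "\<And>k. cfun.subspace (W k)" and f: "f \<in> U k" and g: "g \<in> V l"
  shows "rankin_cohen D n k l f g \<in> W (k + l + 2 * n)"
  unfolding rankin_cohen_def
proof (intro cfun.subspace_sum cfun.subspace_scale assms(4))
  fix r assume "r \<in> {..n}"
  have "(D ^^ r) f \<in> U (k + 2 * r)" for r
    by (induction r) (use f assms(1)[of _ "k + 2 * r" for r] in auto)
  moreover have "(D ^^ r) g \<in> V (l + 2 * r)" for r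
    by (induction r) (use g assms(2)[of _ "l + 2 * r" for r] in auto)
  ultimately have "(D ^^ r) f * (D ^^ (n - r)) g \<in> W (k + 2 * r + (l + 2 * (n - r)))"
    by (intro assms(3))
  also have "k + 2 * r + (l + 2 * (n - r)) = k + l + 2 * n"
    using \<open>r \<in> {..n}\<close> by simp
  finally show "(D ^^ r) f * (D ^^ (n - r)) g \<in> W (k + l + 2 * n)" .
qed

section \<open>Derivations of the algebra of quasimodular forms\<close>

locale quasimodular_derivation = uhp_derivation quasimodular_algebra D for D
begin

lemma D_diff: "f \<in> quasimodular_algebra \<Longrightarrow> g \<in> quasimodular_algebra \<Longrightarrow> D (f - g) = D f - D g"
proof -
  have diff: "u - v = u + cscale (- 1) v" for u v :: uhp_fun
    by (simp add: uhp_fun_simps)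
  assume "f \<in> quasimodular_algebra" "g \<in> quasimodular_algebra"
  then show ?thesis
    unfolding diff by (simp only: D_add D_cscale cscale_closed)
qed

lemma D_one: "D 1 = 0"
  using D_mult[of 1 1] generators_in_algebra(1) by simp

lemma D_square: "f \<in> quasimodular_algebra \<Longrightarrow> D (f ^ 2) = 2 * f * D f"
  by (simp add: power2_eq_square D_mult algebra_simps mult_2)

lemma D_cube: "f \<in> quasimodular_algebra \<Longrightarrow> D (f ^ 3) = 3 * f ^ 2 * D f"
  by (simp add: power3_eq_cube power2_eq_square D_mult qm.mult_closed algebra_simps)

lemma D_Delta: "D Delta = 3 * E4 ^ 2 * D E4 - 2 * E6 * D E6"
  by (simp add: Delta_def D_diff D_square D_cube quasimodular_algebra_power generators_in_algebra)

text \<open>Weights and depths add under multiplication, so by the Leibniz rule the property passes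
  from the three generators to monomials, and then to their spans by linearity.\<close>

lemma D_depth:
  assumes "D E2 \<in> quasimodular_forms_depth 4 1" "D E4 \<in> quasimodular_forms_depth 6 0"
    "D E6 \<in> quasimodular_forms_depth 8 0" and "f \<in> quasimodular_forms_depth k s"
  shows "D f \<in> quasimodular_forms_depth (k + 2) s"
proof -
  \<comment> \<open>Membership of \<open>f\<close> is included because each Leibniz term multiplies
    a derivative by an undifferentiated factor.\<close>
  define B where "B f k s \<longleftrightarrow> f \<in> quasimodular_forms_depth k s \<and> D f \<in> quasimodular_forms_depth (k + 2) s" for f k s
  have mult: "B (f * g) (k + l) (s + t)" if "B f k s" "B g l t" for f g k l s t
  proof -
    have "D f * g \<in> quasimodular_forms_depth (k + 2 + l) (s + t)" "f * D g \<in> quasimodular_forms_depth (k + (l + 2)) (s + t)"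
      "f * g \<in> quasimodular_forms_depth (k + l) (s + t)"
      using that unfolding B_def by (blast intro: quasimodular_forms_depth_mult)+
    moreover have "D (f * g) = D f * g + f * D g"
      using that by (intro D_mult) (auto simp: B_def intro: quasimodular_forms_depth_in_algebra)
    ultimately show ?thesis
      by (simp add: B_def cfun.subspace_add[OF subspace_quasimodular_forms_depth] ac_simps)
  qed
  have pow: "B (f ^ n) (n * k) (n * s)" if "B f k s" for f k s n
  proof (induction n)
    case 0
    show "B (f ^ 0) (0 * k) (0 * s)"
      by (simp add: B_def one_in_depth D_one cfun.subspace_0[OF subspace_quasimodular_forms_depth])
  next
    case (Suc n)
    show "B (f ^ Suc n) (Suc n * k) (Suc n * s)" using mult[OF that Suc.IH] by simp
  qed
  have "B E2 2 1" "B E4 4 0" "B E6 6 0"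
    using assms E2_in_depth E4_in_depth E6_in_depth by (simp_all add: B_def)
  from pow[OF this(1)] pow[OF this(2)] pow[OF this(3)]
  have mon: "D (E2 ^ h * E4 ^ i * E6 ^ j) \<in> quasimodular_forms_depth (2 * h + 4 * i + 6 * j + 2) h" for h i j
    using mult[OF mult] by (fastforce simp: B_def mult_ac)
  have D0: "D 0 = 0" using D_diff[of 1 1] generators_in_algebra by simp
  define T where "T = {f. f \<in> quasimodular_algebra \<and> D f \<in> quasimodular_forms_depth (k + 2) s}"
  have "quasimodular_forms_depth k s \<subseteq> T"
    unfolding quasimodular_forms_depth_altdef[of k]
  proof (rule cfun.span_minimal)
    show "{E2 ^ h * E4 ^ i * E6 ^ j |h i j. h \<le> s \<and> 2 * h + 4 * i + 6 * j = k} \<subseteq> T"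
    proof clarify
      fix h i j assume "h \<le> s" "k = 2 * h + 4 * i + 6 * j"
      then have "D (E2 ^ h * E4 ^ i * E6 ^ j) \<in> quasimodular_forms_depth (k + 2) s"
        using mon[of h i j] quasimodular_forms_depth_mono[of h s] by blast
      then show "E2 ^ h * E4 ^ i * E6 ^ j \<in> T"
        by (simp add: T_def qm.mult_closed quasimodular_algebra_power generators_in_algebra)
    qed
    show "cfun.subspace T"
      using subspace_quasimodular_forms_depth[of "k + 2" s] subspace
      by (intro cfun.subspaceI) (auto simp: T_def D0 D_add D_cscale intro: add_closed cscale_closed
          cfun.subspace_0 cfun.subspace_add cfun.subspace_scale)
  qed
  then show ?thesis using assms(4) by (auto simp: T_def)
qed

end

lemma derivation_on_combination:
  assumes "derivation_on quasimodular_algebra \<delta>" "derivation_on quasimodular_algebra \<epsilon>"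
  shows "derivation_on quasimodular_algebra (\<lambda>f. cscale a (\<delta> f) + \<epsilon> f)"
proof -
  interpret \<delta>: quasimodular_derivation \<delta> by unfold_locales fact
  interpret \<epsilon>: quasimodular_derivation \<epsilon> by unfold_locales fact
  show ?thesis
    unfolding derivation_on_def linear_map_on_def
    by (auto simp: \<delta>.D_add \<epsilon>.D_add \<delta>.D_cscale \<epsilon>.D_cscale \<delta>.D_mult \<epsilon>.D_mult
        intro!: qm.add_closed qm.cscale_closed \<delta>.D_closed \<epsilon>.D_closed)
      (simp_all add: uhp_fun_simps algebra_simps)
qed

section \<open>Bilinear extension from homogeneous elements\<close>

lemma linear_map_on_closed: "linear_map_on A T \<Longrightarrow> f \<in> A \<Longrightarrow> T f \<in> A"
  and linear_map_on_add: "linear_map_on A T \<Longrightarrow> f \<in> A \<Longrightarrow> g \<in> A \<Longrightarrow> T (f + g) = T f + T g"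
  and linear_map_on_cscale: "linear_map_on A T \<Longrightarrow> f \<in> A \<Longrightarrow> T (cscale c f) = cscale c (T f)"
  by (auto simp: linear_map_on_def)

lemma linear_map_onI:
  assumes "\<And>f. f \<in> A \<Longrightarrow> T f \<in> A" "\<And>f g. f \<in> A \<Longrightarrow> g \<in> A \<Longrightarrow> T (f + g) = T f + T g"
    "\<And>c f. f \<in> A \<Longrightarrow> T (cscale c f) = cscale c (T f)"
  shows "linear_map_on A T"
  using assms by (simp add: linear_map_on_def)

lemma linear_map_on_compose: "linear_map_on A S \<Longrightarrow> linear_map_on A T \<Longrightarrow> linear_map_on A (\<lambda>f. S (T f))"
  by (simp add: linear_map_on_def)

context uhp_subalgebra
begin

lemma linear_map_on_0:
  assumes "linear_map_on A T"
  shows "T 0 = 0"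
proof -
  have "T (cscale 0 0) = cscale 0 (T 0)"
    using assms cfun.subspace_0[OF subspace] by (rule linear_map_on_cscale)
  then show ?thesis by (simp only: cfun.scale_zero_left)
qed

lemma linear_map_on_sum:
  assumes "\<And>i. i \<in> I \<Longrightarrow> linear_map_on A (T i)"
  shows "linear_map_on A (\<lambda>f. \<Sum>i\<in>I. T i f)"
proof (rule linear_map_onI)
  show "(\<Sum>i\<in>I. T i f) \<in> A" if "f \<in> A" for f
    using that assms by (intro sum_closed) (rule linear_map_on_closed)
  show "(\<Sum>i\<in>I. T i (f + g)) = (\<Sum>i\<in>I. T i f) + (\<Sum>i\<in>I. T i g)" if "f \<in> A" "g \<in> A" for f g
    unfolding sum.distrib[symmetric] by (intro sum.cong refl linear_map_on_add[OF assms] that)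
  show "(\<Sum>i\<in>I. T i (cscale c f)) = cscale c (\<Sum>i\<in>I. T i f)" if "f \<in> A" for c f
    unfolding cscale_sum by (intro sum.cong refl linear_map_on_cscale[OF assms] that)
qed

lemma bilinear_map_on_mult: "bilinear_map_on A (\<lambda>f g. f * g)"
  unfolding bilinear_map_on_def
  by (auto intro!: linear_map_onI mult_closed simp: distrib_left distrib_right cscale_simps)

end

lemma (in uhp_derivation) bilinear_map_on_rankin_cohen: "bilinear_map_on A (rankin_cohen D n k l)"
  unfolding bilinear_map_on_def
proof (intro conjI ballI linear_map_onI)
  fix f g g' c assume f: "f \<in> A" and g: "g \<in> A"
  show "rankin_cohen D n k l f g \<in> A" by (intro rankin_cohen_closed f g)
  show "rankin_cohen D n k l f (cscale c g) = cscale c (rankin_cohen D n k l f g)"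
    unfolding rankin_cohen_def cscale_sum
    by (intro sum.cong refl) (simp only: Dpow_cscale[OF g] cscale_simps ac_simps)
  show "rankin_cohen D n k l (cscale c f) g = cscale c (rankin_cohen D n k l f g)"
    unfolding rankin_cohen_def cscale_sum
    by (intro sum.cong refl) (simp only: Dpow_cscale[OF f] cscale_simps ac_simps)
  assume g': "g' \<in> A"
  show "rankin_cohen D n k l f (g + g') = rankin_cohen D n k l f g + rankin_cohen D n k l f g'"
    unfolding rankin_cohen_def sum.distrib[symmetric]
    by (intro sum.cong refl) (simp only: Dpow_add[OF g g'] distrib_left cscale_simps)
next
  fix f f' g c assume f: "f \<in> A" and g: "g \<in> A" and f': "f' \<in> A"
  show "rankin_cohen D n k l (f + f') g = rankin_cohen D n k l f g + rankin_cohen D n k l f' g"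
    unfolding rankin_cohen_def sum.distrib[symmetric]
    by (intro sum.cong refl) (simp only: Dpow_add[OF f f'] distrib_right cscale_simps)
qed (auto intro: rankin_cohen_closed)

lemma linear_map_on_eqI:
  assumes S: "linear_map_on quasimodular_algebra S" and T: "linear_map_on quasimodular_algebra T"
    and eq: "\<And>k f. f \<in> quasimodular_forms k \<Longrightarrow> S f = T f" and f: "f \<in> quasimodular_algebra"
  shows "S f = T f"
  using f
proof (induction f rule: quasimodular_algebra_induct)
  case zero
  show "S 0 = T 0" by (simp only: qm.linear_map_on_0[OF S] qm.linear_map_on_0[OF T])
next
  case (add f g)
  show "S (f + g) = T (f + g)"
    by (simp only: linear_map_on_add[OF S add(1,2)] linear_map_on_add[OF T add(1,2)] add(3,4))
next
  case (cscale c f)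
  show "S (cscale c f) = T (cscale c f)"
    by (simp only: linear_map_on_cscale[OF S cscale(1)] linear_map_on_cscale[OF T cscale(1)] cscale(2))
qed (rule eq)

lemma bilinear_map_onD:
  assumes "bilinear_map_on A \<beta>"
  shows "f \<in> A \<Longrightarrow> linear_map_on A (\<beta> f)" "g \<in> A \<Longrightarrow> linear_map_on A (\<lambda>f. \<beta> f g)"
    "f \<in> A \<Longrightarrow> g \<in> A \<Longrightarrow> \<beta> f g \<in> A"
  using assms by (auto simp: bilinear_map_on_def linear_map_on_def)

lemma bilinear_map_on_eqI:
  assumes \<beta>: "bilinear_map_on quasimodular_algebra \<beta>" and \<gamma>: "bilinear_map_on quasimodular_algebra \<gamma>"
    and eq: "\<And>k l f g. f \<in> quasimodular_forms k \<Longrightarrow> g \<in> quasimodular_forms l \<Longrightarrow> \<beta> f g = \<gamma> f g"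
    and f: "f \<in> quasimodular_algebra" and g: "g \<in> quasimodular_algebra"
  shows "\<beta> f g = \<gamma> f g"
proof -
  have "\<beta> f g = \<gamma> f g" if f: "f \<in> quasimodular_forms k" for f k
    by (rule linear_map_on_eqI[OF bilinear_map_onD(1)[OF \<beta>] bilinear_map_onD(1)[OF \<gamma>] _ g])
      (use f eq quasimodular_forms_in_algebra in auto)
  then show ?thesis
    by (rule linear_map_on_eqI[OF bilinear_map_onD(2)[OF \<beta> g] bilinear_map_onD(2)[OF \<gamma> g] _ f])
qed

text \<open>Associativity is trilinear, so homogeneous arguments suffice. For these the inner
  bracket of order \<open>r\<close> has weight \<open>k + l + 2 * r\<close> or
  \<open>l + m + 2 * r\<close>, so the outer one is again given by \<open>rankin_cohen\<close>, and
  \<open>rankin_cohen_assoc\<close> applies.\<close>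

lemma (in quasimodular_derivation) formal_deformation_rankin_cohen:
  assumes weight: "\<And>k f. f \<in> quasimodular_forms k \<Longrightarrow> D f \<in> quasimodular_forms (k + 2)"
    and \<mu>: "extends_rankin_cohen D \<mu>"
  shows "formal_deformation quasimodular_algebra \<mu>"
proof -
  let ?A = quasimodular_algebra
  have bil: "bilinear_map_on ?A (\<mu> n)" for n
    using \<mu> by (simp add: extends_rankin_cohen_def)
  have hom: "\<mu> n f g = rankin_cohen D n k l f g"
    if "f \<in> quasimodular_forms k" "g \<in> quasimodular_forms l" for n k l f g
    using \<mu> that by (simp add: extends_rankin_cohen_def)
  have weight_rc: "rankin_cohen D n k l f g \<in> quasimodular_forms (k + l + 2 * n)"
    if "f \<in> quasimodular_forms k" "g \<in> quasimodular_forms l" for n k l f g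
    by (rule rankin_cohen_homogeneous[where U = quasimodular_forms and V = quasimodular_forms])
      (use that weight quasimodular_forms_mult subspace_quasimodular_forms in auto)
  note lin = bilinear_map_onD[OF bil] qm.linear_map_on_sum linear_map_on_compose
  have "(\<Sum>r\<le>n. \<mu> (n - r) (\<mu> r f g) h) = (\<Sum>r\<le>n. \<mu> (n - r) f (\<mu> r g h))"
    if f: "f \<in> ?A" and g: "g \<in> ?A" and h: "h \<in> ?A" for n f g h
  proof -
    have 1: "(\<Sum>r\<le>n. \<mu> (n - r) (\<mu> r f g) h) = (\<Sum>r\<le>n. \<mu> (n - r) f (\<mu> r g h))"
      if f: "f \<in> quasimodular_forms k" and g: "g \<in> quasimodular_forms l" and h: "h \<in> quasimodular_forms m"
      for f g h k l m
    proof -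
      have "\<mu> (n - r) (\<mu> r f g) h = rankin_cohen D (n - r) (k + l + 2 * r) m (rankin_cohen D r k l f g) h" for r
        using hom[OF weight_rc[OF f g] h] by (simp only: hom[OF f g])
      moreover have "\<mu> (n - r) f (\<mu> r g h) = rankin_cohen D (n - r) k (l + m + 2 * r) f (rankin_cohen D r l m g h)" for r
        using hom[OF f weight_rc[OF g h]] by (simp only: hom[OF g h])
      ultimately show ?thesis
        using rankin_cohen_assoc[of f g h n k l m] f g h by (simp only: quasimodular_forms_in_algebra)
    qed
    \<comment> \<open>From here on one argument at a time is freed from homogeneity:
      \<open>h\<close>, then \<open>g\<close>, then \<open>f\<close>.\<close>
    have 2: "(\<Sum>r\<le>n. \<mu> (n - r) (\<mu> r f g) h) = (\<Sum>r\<le>n. \<mu> (n - r) f (\<mu> r g h))"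
      if f: "f \<in> quasimodular_forms k" and g: "g \<in> quasimodular_forms l" for f g k l
    proof (rule linear_map_on_eqI[where f = h])
      have f': "f \<in> ?A" and g': "g \<in> ?A"
        using f g quasimodular_forms_in_algebra by auto
      show "linear_map_on ?A (\<lambda>h. \<Sum>r\<le>n. \<mu> (n - r) (\<mu> r f g) h)"
        by (intro lin f' g')
      show "linear_map_on ?A (\<lambda>h. \<Sum>r\<le>n. \<mu> (n - r) f (\<mu> r g h))"
        by (intro qm.linear_map_on_sum linear_map_on_compose[OF lin(1) lin(1)] f' g')
    qed (use 1 f g h in auto)
    have 3: "(\<Sum>r\<le>n. \<mu> (n - r) (\<mu> r f g) h) = (\<Sum>r\<le>n. \<mu> (n - r) f (\<mu> r g h))"
      if f: "f \<in> quasimodular_forms k" for f k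
    proof (rule linear_map_on_eqI[where f = g])
      have f': "f \<in> ?A" using f quasimodular_forms_in_algebra by auto
      show "linear_map_on ?A (\<lambda>g. \<Sum>r\<le>n. \<mu> (n - r) (\<mu> r f g) h)"
        by (intro qm.linear_map_on_sum linear_map_on_compose[OF lin(2) lin(1)] f' h)
      show "linear_map_on ?A (\<lambda>g. \<Sum>r\<le>n. \<mu> (n - r) f (\<mu> r g h))"
        by (intro qm.linear_map_on_sum linear_map_on_compose[OF lin(1) lin(2)] f' h)
    qed (use 2 f g in auto)
    show ?thesis
    proof (rule linear_map_on_eqI[where f = f])
      show "linear_map_on ?A (\<lambda>f. \<Sum>r\<le>n. \<mu> (n - r) (\<mu> r f g) h)"
        by (intro qm.linear_map_on_sum linear_map_on_compose[OF lin(2) lin(2)] g h)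
      show "linear_map_on ?A (\<lambda>f. \<Sum>r\<le>n. \<mu> (n - r) f (\<mu> r g h))"
        by (intro qm.linear_map_on_sum lin(2) lin(3) g h)
    qed (use 3 f in auto)
  qed
  moreover have "\<mu> 0 f g = f * g" if "f \<in> ?A" "g \<in> ?A" for f g
  proof (rule bilinear_map_on_eqI[OF bil qm.bilinear_map_on_mult _ that])
    show "\<mu> 0 f g = f * g" if "f \<in> quasimodular_forms k" "g \<in> quasimodular_forms l" for k l f g
      by (simp add: hom[OF that] rankin_cohen_def)
  qed
  ultimately show ?thesis
    using bil by (simp add: formal_deformation_def)
qed

section \<open>Weight decompositions and maps prescribed weight by weight\<close>

text \<open>\<open>N\<close> is a bound rather than the exact top weight, so that two decompositions
  can be given a common bound before they are added or compared.\<close>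

definition weight_decomposition :: "uhp_fun \<Rightarrow> (nat \<Rightarrow> uhp_fun) \<Rightarrow> nat \<Rightarrow> bool" where
  "weight_decomposition f F N \<longleftrightarrow>
     (\<forall>k. F k \<in> quasimodular_forms k) \<and> (\<forall>k>N. F k = 0) \<and> f = (\<Sum>k\<le>N. F k)"

lemma weight_decompositionD:
  assumes "weight_decomposition f F N"
  shows "F k \<in> quasimodular_forms k" "k > N \<Longrightarrow> F k = 0" "(\<Sum>k\<le>N. F k) = f"
  using assms by (auto simp: weight_decomposition_def)

lemma weight_decomposition_mono:
  assumes "weight_decomposition f F N" "N \<le> M"
  shows "weight_decomposition f F M"
proof -
  have "(\<Sum>k\<le>N. F k) = (\<Sum>k\<le>M. F k)"
    using assms by (intro sum.mono_neutral_left) (auto simp: weight_decomposition_def)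
  then show ?thesis using assms by (auto simp: weight_decomposition_def)
qed

lemma weight_decomposition_add:
  assumes "weight_decomposition f F N" "weight_decomposition g G N"
  shows "weight_decomposition (f + g) (\<lambda>k. F k + G k) N"
  using assms by (simp add: weight_decomposition_def sum.distrib cfun.subspace_add[OF subspace_quasimodular_forms])

lemma weight_decomposition_cscale:
  assumes "weight_decomposition f F N"
  shows "weight_decomposition (cscale c f) (\<lambda>k. cscale c (F k)) N"
  using assms by (simp add: weight_decomposition_def cscale_sum cfun.subspace_scale[OF subspace_quasimodular_forms])

lemma weight_decomposition_homogeneous:
  assumes "f \<in> quasimodular_forms k"
  shows "weight_decomposition f (\<lambda>j. if j = k then f else 0) k"
  using assms by (auto simp: weight_decomposition_def sum.delta cfun.subspace_0[OF subspace_quasimodular_forms])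

lemma weight_decomposition_exists:
  assumes "f \<in> quasimodular_algebra"
  shows "\<exists>F N. weight_decomposition f F N"
  using assms
proof (induction f rule: quasimodular_algebra_induct)
  case zero
  show "\<exists>F N. weight_decomposition 0 F N"
    using weight_decomposition_homogeneous[of 0 0] cfun.subspace_0[OF subspace_quasimodular_forms] by blast
next
  case (add f g)
  then obtain F N G M where "weight_decomposition f F N" "weight_decomposition g G M" by blast
  then have "weight_decomposition (f + g) (\<lambda>k. F k + G k) (max N M)"
    by (intro weight_decomposition_add) (auto elim: weight_decomposition_mono)
  then show "\<exists>F N. weight_decomposition (f + g) F N" by blast
next
  case (cscale c f)
  then show "\<exists>F N. weight_decomposition (cscale c f) F N"
    using weight_decomposition_cscale by blast
next
  case (homogeneous k f)
  then show "\<exists>F N. weight_decomposition f F N"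
    using weight_decomposition_homogeneous by blast
qed

text \<open>An arbitrary choice at this point; it becomes canonical under
  \<open>weights_independent\<close>.\<close>

definition weight_component :: "uhp_fun \<Rightarrow> nat \<Rightarrow> uhp_fun" where
  "weight_component f = (SOME F. \<exists>N. weight_decomposition f F N)"

definition graded_extension :: "(nat \<Rightarrow> uhp_fun \<Rightarrow> uhp_fun) \<Rightarrow> uhp_fun \<Rightarrow> uhp_fun" where
  "graded_extension T f = (\<Sum>k | weight_component f k \<noteq> 0. T k (weight_component f k))"

text \<open>Directness of the sum of the weight spaces, established below from the existence of a
  generator \<pi>.\<close>

locale graded_quasimodular =
  assumes weights_independent:
    "(\<And>k. F k \<in> quasimodular_forms k) \<Longrightarrow> (\<Sum>k\<le>N. F k) = 0 \<Longrightarrow> k \<le> N \<Longrightarrow> F k = 0"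
begin

lemma weight_component_eq:
  assumes F: "weight_decomposition f F N"
  shows "weight_component f = F"
proof -
  have "\<exists>N. weight_decomposition f (weight_component f) N"
    unfolding weight_component_def by (rule someI[of _ F]) (use F in blast)
  then obtain M where M: "weight_decomposition f (weight_component f) M" by blast
  define K where "K = max N M"
  have K: "weight_decomposition f F K" "weight_decomposition f (weight_component f) K"
    using F M weight_decomposition_mono by (auto simp: K_def)
  have "weight_component f k - F k = 0" if "k \<le> K" for k
  proof (rule weights_independent[OF _ _ that])
    show "weight_component f k - F k \<in> quasimodular_forms k" for k
      by (intro cfun.subspace_diff subspace_quasimodular_forms K[THEN weight_decompositionD(1)])
    show "(\<Sum>k\<le>K. weight_component f k - F k) = 0"
      using K[THEN weight_decompositionD(3)] by (simp only: sum_subtractf) simp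
  qed
  moreover have "weight_component f k = F k" if "k > K" for k
    using K[THEN weight_decompositionD(2), OF that] by simp
  ultimately show ?thesis
    by (intro ext[where f = "weight_component f"]) (metis eq_iff_diff_eq_0 not_le)
qed

lemma weight_component_in_algebra: "f \<in> quasimodular_algebra \<Longrightarrow> weight_component f k \<in> quasimodular_algebra"
  using weight_decomposition_exists weight_component_eq weight_decompositionD(1)
    quasimodular_forms_in_algebra by metis

lemma graded_extension_eq:
  assumes "\<And>k. linear_map_on quasimodular_algebra (T k)" "weight_decomposition f F N"
  shows "graded_extension T f = (\<Sum>k\<le>N. T k (F k))"
  unfolding graded_extension_def weight_component_eq[OF assms(2)]
  using assms(2) qm.linear_map_on_0[OF assms(1)]
  by (intro sum.mono_neutral_left) (auto simp: weight_decomposition_def not_le[symmetric])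

lemma graded_extension_homogeneous:
  assumes "\<And>k. linear_map_on quasimodular_algebra (T k)" "f \<in> quasimodular_forms k"
  shows "graded_extension T f = T k f"
proof -
  have "graded_extension T f = (\<Sum>j\<le>k. T j (if j = k then f else 0))"
    using assms(1) weight_decomposition_homogeneous[OF assms(2)] by (rule graded_extension_eq)
  also have "\<dots> = (\<Sum>j\<le>k. if j = k then T k f else 0)"
    using qm.linear_map_on_0[OF assms(1)] by (intro sum.cong) auto
  finally show ?thesis by (simp add: sum.delta)
qed

lemma linear_map_on_graded_extension:
  assumes T: "\<And>k. linear_map_on quasimodular_algebra (T k)"
  shows "linear_map_on quasimodular_algebra (graded_extension T)"
proof (rule linear_map_onI)
  fix f assume f: "f \<in> quasimodular_algebra"
  then obtain F N where F: "weight_decomposition f F N" using weight_decomposition_exists by blast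
  then have F': "F k \<in> quasimodular_algebra" for k
    using quasimodular_forms_in_algebra by (auto simp: weight_decomposition_def)
  show "graded_extension T f \<in> quasimodular_algebra"
    unfolding graded_extension_eq[OF T F] by (intro qm.sum_closed linear_map_on_closed[OF T] F')
  show "graded_extension T (cscale c f) = cscale c (graded_extension T f)" for c
    unfolding graded_extension_eq[OF T F] graded_extension_eq[OF T weight_decomposition_cscale[OF F]]
    by (simp only: linear_map_on_cscale[OF T F'] cscale_sum)
  fix g assume g: "g \<in> quasimodular_algebra"
  then obtain G M where G: "weight_decomposition g G M" using weight_decomposition_exists by blast
  then have G': "G k \<in> quasimodular_algebra" for k
    using quasimodular_forms_in_algebra by (auto simp: weight_decomposition_def)
  have FG: "weight_decomposition f F (max N M)" "weight_decomposition g G (max N M)"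
    using F G by (auto elim: weight_decomposition_mono)
  show "graded_extension T (f + g) = graded_extension T f + graded_extension T g"
    unfolding graded_extension_eq[OF T FG(1)] graded_extension_eq[OF T FG(2)]
      graded_extension_eq[OF T weight_decomposition_add[OF FG]]
    by (simp only: linear_map_on_add[OF T F' G'] sum.distrib)
qed

text \<open>The graded extension is applied twice: in \<open>g\<close> for each weight component of
  \<open>f\<close>, and then in \<open>f\<close>.\<close>

lemma bilinear_extension_exists:
  assumes \<beta>: "\<And>k l. bilinear_map_on quasimodular_algebra (\<beta> k l)"
  shows "\<exists>\<mu>. bilinear_map_on quasimodular_algebra \<mu> \<and>
     (\<forall>k l. \<forall>f\<in>quasimodular_forms k. \<forall>g\<in>quasimodular_forms l. \<mu> f g = \<beta> k l f g)"
proof -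
  let ?A = quasimodular_algebra
  define \<mu> where "\<mu> f g = graded_extension (\<lambda>k f. graded_extension (\<lambda>l. \<beta> k l f) g) f" for f g
  have right: "linear_map_on ?A (graded_extension (\<lambda>l. \<beta> k l f))" if "f \<in> ?A" for k f
    by (intro linear_map_on_graded_extension bilinear_map_onD(1)[OF \<beta>] that)
  \<comment> \<open>For fixed \<open>g\<close> this is a sum over the weight components of
    \<open>g\<close>, an index set independent of \<open>f\<close>, so linearity in \<open>f\<close>
    holds termwise.\<close>
  have left: "linear_map_on ?A (\<lambda>f. graded_extension (\<lambda>l. \<beta> k l f) g)" if "g \<in> ?A" for k g
    unfolding graded_extension_def
    by (intro qm.linear_map_on_sum bilinear_map_onD(2)[OF \<beta>] weight_component_in_algebra that)
  have "linear_map_on ?A (\<mu> f)" if "f \<in> ?A" for f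
    unfolding \<mu>_def graded_extension_def[of _ f]
    by (intro qm.linear_map_on_sum right weight_component_in_algebra that)
  moreover have "linear_map_on ?A (\<lambda>f. \<mu> f g)" if "g \<in> ?A" for g
    unfolding \<mu>_def by (intro linear_map_on_graded_extension left that)
  moreover have "\<mu> f g = \<beta> k l f g" if f: "f \<in> quasimodular_forms k" and g: "g \<in> quasimodular_forms l" for k l f g
  proof -
    have "\<mu> f g = graded_extension (\<lambda>l. \<beta> k l f) g"
      unfolding \<mu>_def by (rule graded_extension_homogeneous[OF left f])
        (use g quasimodular_forms_in_algebra in blast)
    also have "\<dots> = \<beta> k l f g"
      by (rule graded_extension_homogeneous[OF bilinear_map_onD(1)[OF \<beta>] g])
        (use f quasimodular_forms_in_algebra in blast)
    finally show ?thesis .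
  qed
  ultimately show ?thesis
    unfolding bilinear_map_on_def by (intro exI[of _ \<mu>]) simp
qed

lemma extends_rankin_cohen_exists:
  assumes "derivation_on quasimodular_algebra D"
  shows "\<exists>\<mu>. extends_rankin_cohen D \<mu>"
proof -
  interpret quasimodular_derivation D by unfold_locales fact
  have "\<forall>n. \<exists>\<mu>. bilinear_map_on quasimodular_algebra \<mu> \<and>
     (\<forall>k l. \<forall>f\<in>quasimodular_forms k. \<forall>g\<in>quasimodular_forms l. \<mu> f g = rankin_cohen D n k l f g)"
    by (intro allI bilinear_extension_exists bilinear_map_on_rankin_cohen)
  from choice[OF this] show ?thesis
    unfolding extends_rankin_cohen_def .
qed

end

section \<open>The derivations \<open>\<pi>\<close> and \<open>w\<close>\<close>

lemma span_pairD:
  assumes "f \<in> cfun.span {x, y}"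
  obtains a b where "f = cscale a x + cscale b y"
proof -
  from assms obtain a b where "f - cscale a x - cscale b y = 0"
    by (auto simp: cfun.span_breakdown_eq)
  then show ?thesis using that[of a b] by (simp add: algebra_simps)
qed

text \<open>The weight equation with \<open>h \<le> 1\<close> leaves two monomials. This lemma and
  the next two parametrise \<open>\<pi> E4\<close>, \<open>\<pi> E6\<close> and the test bracket of
  weight \<open>12\<close>.\<close>

lemma depth_6_1:
  assumes "f \<in> quasimodular_forms_depth 6 1"
  obtains a b where "f = cscale a (E2 * E4) + cscale b E6"
proof -
  have "{E2 ^ h * E4 ^ i * E6 ^ j | h i j. h \<le> 1 \<and> 2 * h + 4 * i + 6 * j = 6} \<subseteq> {E2 * E4, E6}"
  proof
    fix x assume "x \<in> {E2 ^ h * E4 ^ i * E6 ^ j | h i j. h \<le> 1 \<and> 2 * h + 4 * i + 6 * j = 6}"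
    then obtain h i j where x: "x = E2 ^ h * E4 ^ i * E6 ^ j" and hij: "h \<le> 1" "2 * h + 4 * i + 6 * j = 6"
      by blast
    from hij have "h = 1 \<and> i = 1 \<and> j = 0 \<or> h = 0 \<and> i = 0 \<and> j = 1"
      by presburger
    then show "x \<in> {E2 * E4, E6}" using x by auto
  qed
  then have "f \<in> cfun.span {E2 * E4, E6}"
    using assms cfun.span_mono unfolding quasimodular_forms_depth_altdef by blast
  then show ?thesis by (rule span_pairD) (rule that)
qed

lemma depth_8_1:
  assumes "f \<in> quasimodular_forms_depth 8 1"
  obtains a b where "f = cscale a (E4 ^ 2) + cscale b (E2 * E6)"
proof -
  have "{E2 ^ h * E4 ^ i * E6 ^ j | h i j. h \<le> 1 \<and> 2 * h + 4 * i + 6 * j = 8} \<subseteq> {E4 ^ 2, E2 * E6}"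
  proof
    fix x assume "x \<in> {E2 ^ h * E4 ^ i * E6 ^ j | h i j. h \<le> 1 \<and> 2 * h + 4 * i + 6 * j = 8}"
    then obtain h i j where x: "x = E2 ^ h * E4 ^ i * E6 ^ j" and hij: "h \<le> 1" "2 * h + 4 * i + 6 * j = 8"
      by blast
    from hij have "h = 0 \<and> i = 2 \<and> j = 0 \<or> h = 1 \<and> i = 0 \<and> j = 1"
      by presburger
    then show "x \<in> {E4 ^ 2, E2 * E6}" using x by auto
  qed
  then have "f \<in> cfun.span {E4 ^ 2, E2 * E6}"
    using assms cfun.span_mono unfolding quasimodular_forms_depth_altdef by blast
  then show ?thesis by (rule span_pairD) (rule that)
qed

lemma depth_12_0:
  assumes "f \<in> quasimodular_forms_depth 12 0"
  obtains a b where "f = cscale a (E4 ^ 3) + cscale b (E6 ^ 2)"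
proof -
  have "{E2 ^ h * E4 ^ i * E6 ^ j | h i j. h \<le> 0 \<and> 2 * h + 4 * i + 6 * j = 12} \<subseteq> {E4 ^ 3, E6 ^ 2}"
  proof
    fix x assume "x \<in> {E2 ^ h * E4 ^ i * E6 ^ j | h i j. h \<le> 0 \<and> 2 * h + 4 * i + 6 * j = 12}"
    then obtain h i j where x: "x = E2 ^ h * E4 ^ i * E6 ^ j" and hij: "h \<le> 0" "2 * h + 4 * i + 6 * j = 12"
      by blast
    from hij have "h = 0 \<and> i = 3 \<and> j = 0 \<or> h = 0 \<and> i = 0 \<and> j = 2"
      by presburger
    then show "x \<in> {E4 ^ 3, E6 ^ 2}" using x by auto
  qed
  then have "f \<in> cfun.span {E4 ^ 3, E6 ^ 2}"
    using assms cfun.span_mono unfolding quasimodular_forms_depth_altdef by blast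
  then show ?thesis by (rule span_pairD) (rule that)
qed

text \<open>Complex-likeness leaves four coefficients in \<open>\<pi> E4\<close> and
  \<open>\<pi> E6\<close>. The relation between these two makes \<open>\<pi> E4\<close> a multiple
  of \<open>E2 * E4\<close>, and the relation with \<open>E4\<close> then determines \<pi> in every
  weight.\<close>

lemma pi_generator_form:
  assumes "pi_generator \<pi>"
  obtains c where "c \<noteq> 0"
    "\<And>k f. f \<in> quasimodular_forms k \<Longrightarrow> \<pi> f = cscale (c * of_nat k) (E2 * f)"
proof -
  have cl: "complex_like \<pi>" and nz: "\<exists>f\<in>quasimodular_algebra. \<pi> f \<noteq> 0"
    using assms by (auto simp: pi_generator_def pi_derivations_def)
  have rel: "of_nat k * f * \<pi> g - of_nat l * g * \<pi> f = 0"
    if "f \<in> quasimodular_forms_depth k s" "g \<in> quasimodular_forms_depth l t" for k l s t f g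
    using assms that unfolding pi_generator_def pi_derivations_def by blast
  from cl have der: "derivation_on quasimodular_algebra \<pi>"
    and depth: "f \<in> quasimodular_forms_depth k s \<Longrightarrow> \<pi> f \<in> quasimodular_forms_depth (k + 2) (s + 1)" for f k s
    by (auto simp: complex_like_def)
  interpret quasimodular_derivation \<pi> by unfold_locales fact
  have "\<pi> E4 \<in> quasimodular_forms_depth 6 1" "\<pi> E6 \<in> quasimodular_forms_depth 8 1"
    using depth[OF E4_in_depth] depth[OF E6_in_depth] by simp_all
  then obtain a b c d where E4: "\<pi> E4 = cscale a (E2 * E4) + cscale b E6"
    and E6: "\<pi> E6 = cscale c (E4 ^ 2) + cscale d (E2 * E6)"
    by (elim depth_6_1 depth_8_1)
  \<comment> \<open>The relation \<open>4 E4 \<pi>(E6) - 6 E6 \<pi>(E4) = 0\<close>, sorted by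
    monomials; the coefficient of \<open>E6 ^ 2\<close> isolates \<open>b\<close>.\<close>
  have "cscale (4 * d - 6 * a) (E2 * E4 * E6) + cscale (4 * c) (E4 ^ 3) + cscale (- 6 * b) (E6 ^ 2) = 0"
    using rel[OF E4_in_depth E6_in_depth] unfolding E4 E6
    by (simp add: uhp_fun_simps algebra_simps power2_eq_square power3_eq_cube)
  then have b: "b = 0"
    using weight_12_relations(2) by fastforce
  have form: "\<pi> f = cscale (a / 4 * of_nat k) (E2 * f)" if f: "f \<in> quasimodular_forms k" for f k
  proof -
    have fA: "f \<in> quasimodular_algebra" using f by (rule quasimodular_forms_in_algebra)
    \<comment> \<open>Since \<open>E4\<close> has weight \<open>4\<close> and
      \<open>\<pi> E4 = a E2 E4\<close>, cancelling \<open>4 * E4\<close> produces the constant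
      \<open>a / 4\<close>.\<close>
    have "of_nat 4 * E4 * \<pi> f - of_nat k * f * \<pi> E4 = 0"
      by (rule rel[OF E4_in_depth]) (use f in \<open>simp add: quasimodular_forms_eq_depth\<close>)
    then have "E4 * \<pi> f = E4 * cscale (a / 4 * of_nat k) (E2 * f)"
      unfolding E4 b by (simp add: uhp_fun_simps) (simp add: field_simps)
    moreover have "E4 \<noteq> 0" unfolding E4_def by (rule eisenstein_neq_0)
    ultimately show ?thesis
      by (intro quasimodular_algebra_mult_left_cancel[OF generators_in_algebra(3) D_closed[OF fA]
            qm.cscale_closed[OF qm.mult_closed[OF generators_in_algebra(2) fA]]])
  qed
  have "a \<noteq> 0"
  proof
    assume "a = 0"
    have "\<pi> f = (\<lambda>_. 0) f" if "f \<in> quasimodular_algebra" for f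
    proof (rule linear_map_on_eqI[OF _ _ _ that])
      show "linear_map_on quasimodular_algebra \<pi>" using der by (simp add: derivation_on_def)
      show "linear_map_on quasimodular_algebra (\<lambda>_. 0)"
        using cfun.subspace_0[OF qm.subspace] by (auto intro!: linear_map_onI)
      show "\<pi> f = 0" if "f \<in> quasimodular_forms k" for k f
        using form[OF that] \<open>a = 0\<close> by simp
    qed
    then show False using nz by blast
  qed
  then show ?thesis using that[of "a / 4"] form by simp
qed

text \<open>Cancelling \<open>c E2\<close>, the map \<open>\<pi>\<close> shows that the weight operator is well defined on the
  algebra: \<open>\<Sum> F k = 0\<close> implies \<open>\<Sum> k F k = 0\<close>. Subtracting \<open>Suc N\<close> times the former from the
  latter removes the top component.\<close>

lemma graded_quasimodular_if_pi_generator: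
  assumes "pi_generator \<pi>"
  shows graded_quasimodular
proof
  obtain c where c: "c \<noteq> 0"
    and form: "\<And>k f. f \<in> quasimodular_forms k \<Longrightarrow> \<pi> f = cscale (c * of_nat k) (E2 * f)"
    using pi_generator_form[OF assms] by blast
  have "linear_map_on quasimodular_algebra \<pi>"
    using assms by (simp add: pi_generator_def pi_derivations_def complex_like_def derivation_on_def)
  have euler: "(\<Sum>k\<le>N. cscale (of_nat k) (F k)) = 0"
    if F: "\<And>k. F k \<in> quasimodular_forms k" and sum: "(\<Sum>k\<le>N. F k) = 0" for F :: "nat \<Rightarrow> uhp_fun" and N
  proof -
    note FA = quasimodular_forms_in_algebra[OF F]
    have "\<pi> (\<Sum>k\<in>I. F k) = (\<Sum>k\<in>I. cscale (c * of_nat k) (E2 * F k))" if "finite I" for I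
      using that
    proof (induction I rule: finite_induct)
      case empty
      show "\<pi> (\<Sum>k\<in>{}. F k) = (\<Sum>k\<in>{}. cscale (c * of_nat k) (E2 * F k))"
        by (simp only: sum.empty qm.linear_map_on_0[OF \<open>linear_map_on _ \<pi>\<close>])
    next
      case (insert i I)
      show "\<pi> (\<Sum>k\<in>insert i I. F k) = (\<Sum>k\<in>insert i I. cscale (c * of_nat k) (E2 * F k))"
        by (simp only: sum.insert[OF insert.hyps] form[OF F] insert.IH
            linear_map_on_add[OF \<open>linear_map_on _ \<pi>\<close> FA qm.sum_closed[OF FA]])
    qed
    from this[of "{..N}"] have "(\<Sum>k\<le>N. cscale (c * of_nat k) (E2 * F k)) = 0"
      by (simp only: finite_atMost sum qm.linear_map_on_0[OF \<open>linear_map_on _ \<pi>\<close>] simp_thms)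
    also have "(\<Sum>k\<le>N. cscale (c * of_nat k) (E2 * F k)) = E2 * cscale c (\<Sum>k\<le>N. cscale (of_nat k) (F k))"
      by (simp only: cscale_sum sum_distrib_left cscale_simps)
    finally have "E2 = 0 \<or> cscale c (\<Sum>k\<le>N. cscale (of_nat k) (F k)) = 0"
      by (intro quasimodular_algebra_mult_eq_0 generators_in_algebra qm.cscale_closed qm.sum_closed FA)
    moreover have "E2 \<noteq> 0" unfolding E2_def by (rule eisenstein_neq_0)
    ultimately show ?thesis using c by simp
  qed
  fix F :: "nat \<Rightarrow> uhp_fun" and N k
  assume "\<And>k. F k \<in> quasimodular_forms k" "(\<Sum>k\<le>N. F k) = 0" "k \<le> N"
  then show "F k = 0"
  proof (induction N arbitrary: F k)
    case 0
    have "(\<Sum>k\<le>0. F k) = F 0" by simp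
    with "0.prems"(2,3) show "F k = 0" by (metis le_zero_eq)
  next
    case (Suc N)
    define G where "G k = cscale (of_nat k - of_nat (Suc N)) (F k)" for k
    have G: "G k \<in> quasimodular_forms k" for k
      unfolding G_def by (intro cfun.subspace_scale subspace_quasimodular_forms Suc.prems(1))
    have "(\<Sum>k\<le>Suc N. G k) = (\<Sum>k\<le>Suc N. cscale (of_nat k) (F k)) - cscale (of_nat (Suc N)) (\<Sum>k\<le>Suc N. F k)"
      by (simp only: G_def cfun.scale_left_diff_distrib sum_subtractf cscale_sum)
    also have "\<dots> = 0"
      by (simp only: euler[OF Suc.prems(1,2)] Suc.prems(2) cfun.scale_zero_right diff_self)
    finally have "(\<Sum>k\<le>N. G k) = 0"
      by (simp add: G_def)
    then have "G k = 0" if "k \<le> N" for k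
      using Suc.IH[OF G _ that] by blast
    then have F0: "F k = 0" if "k \<le> N" for k
      using that unfolding G_def by (metis cfun.scale_eq_0_iff eq_iff_diff_eq_0 not_less_eq_eq of_nat_eq_iff order_refl)
    have "F (Suc N) = 0"
    proof -
      have "(\<Sum>k\<le>N. F k) = 0" by (rule sum.neutral) (use F0 in auto)
      then show ?thesis using Suc.prems(2) by (metis add_0 sum.atMost_Suc)
    qed
    then show "F k = 0"
      using F0 Suc.prems(3) le_Suc_eq by metis
  qed
qed

section \<open>The Poisson bracket and the derivation \<open>w\<close>\<close>

text \<open>\<open>w_eq\<close> is the defining quotient with the denominator cleared. It determines
  \<open>w\<close> on the algebra because \<open>Delta\<close> is nonzero and there are no zero
  divisors.\<close>

locale poisson_structure =
  fixes P :: "uhp_fun \<Rightarrow> uhp_fun \<Rightarrow> uhp_fun" and w :: "uhp_fun \<Rightarrow> uhp_fun"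
  assumes P: "poisson_bracket_on quasimodular_algebra P"
    and P46: "P E4 E6 = cscale (-2) Delta"
    and P24: "P E2 E4 = cscale (-1/3) (2 * E6 * E2 - E4 ^ 2)"
    and P26: "P E2 E6 = cscale (-1/2) (2 * E4 ^ 2 * E2 - E4 * E6)"
    and w: "derivation_on quasimodular_algebra w"
    and w_eq: "\<And>f. f \<in> quasimodular_algebra \<Longrightarrow> cscale 12 (Delta * w f) = P Delta f"
begin

sublocale w: quasimodular_derivation w
  by unfold_locales (rule w)

lemma P_skew: "f \<in> quasimodular_algebra \<Longrightarrow> g \<in> quasimodular_algebra \<Longrightarrow> P f g = - P g f"
  using P unfolding poisson_bracket_on_def by blast

lemma P_self: "f \<in> quasimodular_algebra \<Longrightarrow> P f f = 0"
proof -
  assume "f \<in> quasimodular_algebra"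
  then have "P f f + P f f = 0" using P_skew by (metis eq_neg_iff_add_eq_0)
  then show ?thesis by (simp add: fun_eq_iff)
qed

lemma P_derivation: "f \<in> quasimodular_algebra \<Longrightarrow> quasimodular_derivation (P f)"
  using P by unfold_locales (simp add: poisson_bracket_on_def)

text \<open>As \<open>P f\<close> is a derivation, \<open>P f Delta\<close> expands into
  \<open>P f E4\<close> and \<open>P f E6\<close>. Skew-symmetry turns it into
  \<open>P Delta f\<close>, and \<open>Delta\<close> is cancelled; so the brackets of the generators
  determine \<open>w\<close> on them.\<close>

lemma w_eqI:
  assumes f: "f \<in> quasimodular_algebra" and g: "g \<in> quasimodular_algebra"
    and eq: "2 * E6 * P f E6 - 3 * E4 ^ 2 * P f E4 = cscale 12 (Delta * g)"
  shows "w f = g"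
proof (rule quasimodular_algebra_mult_left_cancel)
  have "cscale 12 (Delta * w f) = - P f Delta"
    using w_eq[OF f] P_skew[OF Delta_in_algebra f] by simp
  also have "\<dots> = cscale 12 (Delta * g)"
    using eq quasimodular_derivation.D_Delta[OF P_derivation[OF f]] by simp
  finally show "Delta * w f = Delta * g"
    by (simp add: uhp_fun_simps)
qed (use f g in \<open>auto simp: Delta_neq_0 intro: Delta_in_algebra w.D_closed\<close>)

lemma w_E4: "w E4 = cscale (-1/3) E6"
proof (rule w_eqI)
  show "2 * E6 * P E4 E6 - 3 * E4 ^ 2 * P E4 E4 = cscale 12 (Delta * cscale (- 1 / 3) E6)"
    by (simp add: P_self generators_in_algebra P46 uhp_fun_simps)
qed (intro generators_in_algebra qm.cscale_closed)+

lemma w_E6: "w E6 = cscale (-1/2) (E4 ^ 2)"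
proof (rule w_eqI)
  have "P E6 E4 = - P E4 E6" by (intro P_skew generators_in_algebra)
  then show "2 * E6 * P E6 E6 - 3 * E4 ^ 2 * P E6 E4 = cscale 12 (Delta * cscale (- 1 / 2) (E4 ^ 2))"
    by (simp add: P_self generators_in_algebra P46 uhp_fun_simps)
qed (intro generators_in_algebra qm.cscale_closed quasimodular_algebra_power)+

lemma w_E2: "w E2 = cscale (-1/12) E4"
proof (rule w_eqI)
  \<comment> \<open>The terms containing \<open>E2\<close> cancel and leave
    \<open>- E4 * Delta\<close>, so that \<open>w E2\<close> has depth \<open>0\<close>.\<close>
  show "2 * E6 * P E2 E6 - 3 * E4 ^ 2 * P E2 E4 = cscale 12 (Delta * cscale (- 1 / 12) E4)"
    by (simp add: P24 P26 Delta_def uhp_fun_simps field_simps power2_eq_square power3_eq_cube)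
qed (intro generators_in_algebra qm.cscale_closed)+

lemma w_depth:
  assumes "f \<in> quasimodular_forms_depth k s"
  shows "w f \<in> quasimodular_forms_depth (k + 2) s"
proof (rule w.D_depth[OF _ _ _ assms])
  note scale = cfun.subspace_scale[OF subspace_quasimodular_forms_depth]
  show "w E2 \<in> quasimodular_forms_depth 4 1"
    unfolding w_E2 using quasimodular_forms_depth_mono[of 0 1 4] E4_in_depth by (intro scale) auto
  show "w E4 \<in> quasimodular_forms_depth 6 0"
    unfolding w_E4 by (intro scale E6_in_depth)
  show "w E6 \<in> quasimodular_forms_depth 8 0"
    unfolding w_E6 using quasimodular_forms_depth_mult[OF E4_in_depth E4_in_depth]
    by (intro scale) (simp add: power2_eq_square)
qed

text \<open>Both sides obey the Leibniz rule in each argument, with weights adding under products.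
  The identity is first extended in \<open>g\<close> for a generator \<open>f\<close>; skew-symmetry
  then lets the same argument extend it in \<open>f\<close>.\<close>

lemma P_eq:
  assumes "f \<in> quasimodular_forms k" "g \<in> quasimodular_forms l"
  shows "P f g = of_nat k * f * w g - of_nat l * g * w f"
proof -
  define B where "B f k g l \<longleftrightarrow> P f g = of_nat k * f * w g - of_nat l * g * w f" for f g :: uhp_fun and k l :: nat
  have sym: "B g l f k" if "B f k g l" "f \<in> quasimodular_algebra" "g \<in> quasimodular_algebra" for f g k l
    using that P_skew[of g f] by (simp add: B_def)
  have mult: "B f k (g * h) (l + m)"
    if "B f k g l" "B f k h m" "f \<in> quasimodular_algebra" "g \<in> quasimodular_algebra" "h \<in> quasimodular_algebra"
    for f g h k l m
  proof -
    interpret Pf: quasimodular_derivation "P f" by (rule P_derivation) fact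
    have "P f (g * h) = (of_nat k * f * w g - of_nat l * g * w f) * h + g * (of_nat k * f * w h - of_nat m * h * w f)"
      using that by (simp only: B_def Pf.D_mult)
    then show ?thesis
      using that(4,5) by (simp add: B_def w.D_mult algebra_simps)
  qed
  have pow: "B f k (g ^ n) (n * l)"
    if "B f k g l" "f \<in> quasimodular_algebra" "g \<in> quasimodular_algebra" for f k g l n
  proof (induction n)
    case 0
    interpret Pf: quasimodular_derivation "P f" by (rule P_derivation) fact
    show "B f k (g ^ 0) (0 * l)" by (simp add: B_def Pf.D_one w.D_one)
  next
    case (Suc n)
    show "B f k (g ^ Suc n) (Suc n * l)"
      using mult[OF that(1) Suc.IH that(2,3)] that by (simp add: quasimodular_algebra_power)
  qed
  have mon: "B f k (E2 ^ h * E4 ^ i * E6 ^ j) (2 * h + 4 * i + 6 * j)"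
    if "B f k E2 2" "B f k E4 4" "B f k E6 6" "f \<in> quasimodular_algebra" for f k h i j
    using mult[OF mult[OF pow[OF that(1)] pow[OF that(2)]] pow[OF that(3)], of h i j] that(4)
    by (simp add: quasimodular_algebra_power generators_in_algebra qm.mult_closed mult.commute)
  have ext: "B f k g l"
    if gen: "B f k E2 2" "B f k E4 4" "B f k E6 6" and f: "f \<in> quasimodular_algebra"
      and g: "g \<in> quasimodular_forms l" for f k g l
  proof -
    interpret Pf: quasimodular_derivation "P f" by (rule P_derivation) fact
    define S where "S = {g \<in> quasimodular_algebra. B f k g l}"
    have "quasimodular_forms l \<subseteq> S"
      unfolding quasimodular_forms_def
    proof (rule cfun.span_minimal)
      show "{E2 ^ h * E4 ^ i * E6 ^ j |h i j. 2 * h + 4 * i + 6 * j = l} \<subseteq> S"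
        using mon[OF gen f]
        by (auto simp: S_def quasimodular_algebra_power generators_in_algebra qm.mult_closed)
      have "B f k 0 l"
        using Pf.D_diff[of 1 1] w.D_diff[of 1 1] by (simp add: B_def generators_in_algebra)
      moreover have "B f k (u + v) l" if "u \<in> S" "v \<in> S" for u v
      proof -
        have "P f (u + v) = (of_nat k * f * w u - of_nat l * u * w f) + (of_nat k * f * w v - of_nat l * v * w f)"
          and wadd: "w (u + v) = w u + w v"
          using that by (simp_all only: S_def B_def Pf.D_add w.D_add mem_Collect_eq)
        then show ?thesis
          unfolding B_def wadd by (simp add: algebra_simps)
      qed
      moreover have "B f k (cscale c u) l" if "u \<in> S" for u c
        using that by (simp add: S_def B_def Pf.D_cscale w.D_cscale) (simp add: uhp_fun_simps algebra_simps)
      ultimately show "cfun.subspace S"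
        by (intro cfun.subspaceI)
          (auto simp: S_def intro: qm.add_closed qm.cscale_closed cfun.subspace_0[OF qm.subspace])
    qed
    then show ?thesis using g by (auto simp: S_def)
  qed
  \<comment> \<open>One case for each unordered pair of generators; the reversed pairs follow from
    \<open>sym\<close>.\<close>
  have E: "B E2 2 E2 2" "B E4 4 E4 4" "B E6 6 E6 6" "B E2 2 E4 4" "B E2 2 E6 6" "B E4 4 E6 6"
    by (simp_all add: B_def P_self generators_in_algebra)
      (simp_all add: P24 P26 P46 w_E2 w_E4 w_E6 Delta_def uhp_fun_simps field_simps power2_eq_square power3_eq_cube)
  note E' = sym[OF E(4)] sym[OF E(5)] sym[OF E(6)]
  have g: "B E2 2 g l" "B E4 4 g l" "B E6 6 g l"
    by (rule ext[OF _ _ _ _ assms(2)]; use E E' generators_in_algebra in blast)+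
  have gA: "g \<in> quasimodular_algebra" using assms(2) by (rule quasimodular_forms_in_algebra)
  then have "B g l f k"
    using ext[OF sym[OF g(1)] sym[OF g(2)] sym[OF g(3)] gA assms(1)] generators_in_algebra by blast
  then have "B f k g l"
    using sym gA assms(1) quasimodular_forms_in_algebra by blast
  then show ?thesis by (simp add: B_def)
qed

end

theorem theoremA:
  fixes P :: "uhp_fun \<Rightarrow> uhp_fun \<Rightarrow> uhp_fun"
    and w \<pi> :: "uhp_fun \<Rightarrow> uhp_fun"
    and d :: "complex \<Rightarrow> uhp_fun \<Rightarrow> uhp_fun"
  assumes P: "poisson_bracket_on quasimodular_algebra P"
    and P46: "P E4 E6 = cscale (-2) Delta"
    and P24: "P E2 E4 = cscale (-1/3) (2 * E6 * E2 - E4 ^ 2)"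
    and P26: "P E2 E6 = cscale (-1/2) (2 * E4 ^ 2 * E2 - E4 * E6)"
    and w: "derivation_on quasimodular_algebra w"
    and w_eq: "\<And>f. f \<in> quasimodular_algebra \<Longrightarrow> cscale 12 (Delta * w f) = P Delta f"
    and \<pi>: "pi_generator \<pi>"
    and d_def: "\<And>a f. d a f = cscale a (\<pi> f) + w f"
  shows "(\<forall>a k l. \<forall>f\<in>quasimodular_forms k. \<forall>g\<in>quasimodular_forms l.
            P f g = of_nat k * f * d a g - of_nat l * g * d a f) \<and>
         (\<forall>a. (\<forall>n k l. \<forall>f\<in>quasimodular_forms k. \<forall>g\<in>quasimodular_forms l.
                 rankin_cohen (d a) n k l f g \<in> quasimodular_forms (k + l + 2 * n)) \<and>
              (\<exists>\<mu>. extends_rankin_cohen (d a) \<mu>) \<and>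
              (\<forall>\<mu>. extends_rankin_cohen (d a) \<mu> \<longrightarrow> formal_deformation quasimodular_algebra \<mu>)) \<and>
         (\<forall>a. (\<forall>n s t k l. \<forall>f\<in>quasimodular_forms_depth k s. \<forall>g\<in>quasimodular_forms_depth l t.
                 rankin_cohen (d a) n k l f g \<in> quasimodular_forms_depth (k + l + 2 * n) (s + t))
              \<longleftrightarrow> a = 0)"
proof -
  interpret poisson_structure P w
    by unfold_locales (fact P P46 P24 P26 w w_eq)+
  interpret graded_quasimodular
    using \<pi> by (rule graded_quasimodular_if_pi_generator)
  obtain c where c: "c \<noteq> 0"
    and \<pi>_form: "\<And>k f. f \<in> quasimodular_forms k \<Longrightarrow> \<pi> f = cscale (c * of_nat k) (E2 * f)"
    using pi_generator_form[OF \<pi>] by blast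
  have \<pi>_derivation: "derivation_on quasimodular_algebra \<pi>"
    using \<pi> by (simp add: pi_generator_def pi_derivations_def complex_like_def)
  have d_eq: "d a = (\<lambda>f. cscale a (\<pi> f) + w f)" for a
    by (rule ext) (rule d_def)
  have d_derivation: "derivation_on quasimodular_algebra (d a)" for a
    unfolding d_eq by (intro derivation_on_combination \<pi>_derivation w)
  have d_form: "d a f = cscale (a * c * of_nat k) (E2 * f) + w f" if "f \<in> quasimodular_forms k" for a k f
    by (simp add: d_def \<pi>_form[OF that] cscale_simps mult.assoc)
  have d_weight: "d a f \<in> quasimodular_forms (k + 2)" if "f \<in> quasimodular_forms k" for a k f
  proof -
    have "E2 \<in> quasimodular_forms 2"
      using E2_in_depth quasimodular_forms_depth_subset by blast
    then have "E2 * f \<in> quasimodular_forms (k + 2)"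
      using quasimodular_forms_mult[of E2 2 f k] that by (simp add: add.commute)
    moreover have "w f \<in> quasimodular_forms (k + 2)"
      using w_depth quasimodular_forms_depth_subset that unfolding quasimodular_forms_eq_depth[of k] by blast
    ultimately show ?thesis
      unfolding d_form[OF that]
      by (intro cfun.subspace_add cfun.subspace_scale subspace_quasimodular_forms)
  qed
  \<comment> \<open>The contributions of \<pi> to the two products are both
    \<open>a * c * k * l * E2 * f * g\<close>, so they cancel and \<open>a\<close>
    disappears.\<close>
  have part1: "P f g = of_nat k * f * d a g - of_nat l * g * d a f"
    if "f \<in> quasimodular_forms k" "g \<in> quasimodular_forms l" for a k l f g
    unfolding P_eq[OF that] d_form[OF that(1)] d_form[OF that(2)]
    by (simp add: uhp_fun_simps algebra_simps)
  have weight: "rankin_cohen (d a) n k l f g \<in> quasimodular_forms (k + l + 2 * n)"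
    if "f \<in> quasimodular_forms k" "g \<in> quasimodular_forms l" for a n k l f g
    by (rule rankin_cohen_homogeneous[where U = quasimodular_forms and V = quasimodular_forms])
      (use that d_weight quasimodular_forms_mult subspace_quasimodular_forms in auto)
  have deformation: "formal_deformation quasimodular_algebra \<mu>" if "extends_rankin_cohen (d a) \<mu>" for a \<mu>
  proof -
    interpret quasimodular_derivation "d a" by unfold_locales (rule d_derivation)
    show ?thesis using d_weight that by (rule formal_deformation_rankin_cohen)
  qed
  have depth: "rankin_cohen (d 0) n k l f g \<in> quasimodular_forms_depth (k + l + 2 * n) (s + t)"
    if "f \<in> quasimodular_forms_depth k s" "g \<in> quasimodular_forms_depth l t" for n s t k l f g
  proof -
    have d0: "d 0 f = w f" for f by (simp add: d_def)
    show ?thesis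
      \<comment> \<open>The depths \<open>s\<close> and \<open>t\<close> stay fixed along the
        iteration because \<open>w\<close> preserves them.\<close>
      by (rule rankin_cohen_homogeneous[where U = "\<lambda>k. quasimodular_forms_depth k s"
            and V = "\<lambda>k. quasimodular_forms_depth k t" and W = "\<lambda>k. quasimodular_forms_depth k (s + t)"])
        (use that in \<open>auto simp only: d0 intro: w_depth quasimodular_forms_depth_mult subspace_quasimodular_forms_depth\<close>)
  qed
  have no_depth: "a = 0"
    if "\<And>n s t k l f g. f \<in> quasimodular_forms_depth k s \<Longrightarrow> g \<in> quasimodular_forms_depth l t \<Longrightarrow>
        rankin_cohen (d a) n k l f g \<in> quasimodular_forms_depth (k + l + 2 * n) (s + t)" for a
  proof -
    define b where "b = a * c"
    have E4_form: "E4 \<in> quasimodular_forms 4"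
      using E4_in_depth quasimodular_forms_depth_subset by blast
    have dE4: "d a E4 = cscale (4 * b) (E2 * E4) + cscale (-1/3) E6"
      unfolding d_form[OF E4_form] w_E4 by (simp add: b_def mult_ac)
    \<comment> \<open>\<open>d a E4\<close> has weight \<open>6\<close>, whence the factor
      \<open>6 * b\<close>.\<close>
    have "d a (d a E4) = cscale (6 * b) (E2 * d a E4) + w (d a E4)"
      using d_form[OF d_weight[OF E4_form]] by (simp add: b_def mult_ac)
    also have "w (d a E4) = cscale (4 * b) (w E2 * E4 + E2 * w E4) + cscale (-1/3) (w E6)"
      unfolding dE4 by (simp only: w.D_add w.D_cscale w.D_mult generators_in_algebra qm.mult_closed qm.cscale_closed)
    also have "cscale (6 * b) (E2 * d a E4) + (cscale (4 * b) (w E2 * E4 + E2 * w E4) + cscale (-1/3) (w E6))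
        = cscale (24 * b ^ 2) (E2 ^ 2 * E4) + cscale (- 10 / 3 * b) (E2 * E6) + cscale (1 / 6 - b / 3) (E4 ^ 2)"
      unfolding dE4 w_E2 w_E4 w_E6
      by (simp add: uhp_fun_simps field_simps power2_eq_square)
    finally have ddE4: "d a (d a E4) = \<dots>" .
    have gchoose: "(5 :: complex) gchoose 0 = 1" "(5 :: complex) gchoose Suc 0 = 5" "(5 :: complex) gchoose 2 = 10"
      by (simp_all add: gbinomial_prod_rev eval_nat_numeral)
    \<comment> \<open>Both upper arguments are \<open>4 + 2 - 1 = 5\<close>: the indices
      \<open>r = 0\<close> and \<open>r = 2\<close> contribute \<open>10\<close> each, and
      \<open>r = 1\<close> contributes \<open>- 5 * 5\<close>.\<close>
    have "rankin_cohen (d a) 2 4 4 E4 E4 = cscale 20 (E4 * d a (d a E4)) - cscale 25 (d a E4 * d a E4)"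
      by (simp add: rankin_cohen_def numeral_2_eq_2 gchoose[unfolded numeral_2_eq_2])
        (simp add: uhp_fun_simps)
    \<comment> \<open>The terms in \<open>E2 * E4 * E6\<close> cancel, while those in
      \<open>E2 ^ 2 * E4 ^ 2\<close> leave \<open>20 * 24 - 25 * 16 = 80\<close>. So only the three
      monomials of \<open>weight_12_relations(1)\<close> remain.\<close>
    also have "\<dots> = cscale (80 * b ^ 2) (E2 ^ 2 * E4 ^ 2) + cscale (10 / 3 - 20 / 3 * b) (E4 ^ 3)
        + cscale (- 25 / 9) (E6 ^ 2)"
      unfolding ddE4 unfolding dE4 by (simp add: uhp_fun_simps field_simps power2_eq_square power3_eq_cube)
    finally have rc: "rankin_cohen (d a) 2 4 4 E4 E4 = \<dots>" .
    have "rankin_cohen (d a) 2 4 4 E4 E4 \<in> quasimodular_forms_depth 12 0"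
      using that[OF E4_in_depth E4_in_depth, of 2] by simp
    then obtain u v where "rankin_cohen (d a) 2 4 4 E4 E4 = cscale u (E4 ^ 3) + cscale v (E6 ^ 2)"
      by (rule depth_12_0)
    then have "cscale (80 * b ^ 2) (E2 ^ 2 * E4 ^ 2) + cscale (10 / 3 - 20 / 3 * b - u) (E4 ^ 3)
        + cscale (- 25 / 9 - v) (E6 ^ 2) = 0"
      unfolding rc by (simp add: uhp_fun_simps algebra_simps)
    then have "80 * b ^ 2 = 0"
      using weight_12_relations(1) by blast
    then show "a = 0" using c by (simp add: b_def)
  qed
  show ?thesis
  proof (intro conjI allI ballI impI iffI)
    show "a = 0"
      if "\<forall>n s t k l. \<forall>f\<in>quasimodular_forms_depth k s. \<forall>g\<in>quasimodular_forms_depth l t.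
        rankin_cohen (d a) n k l f g \<in> quasimodular_forms_depth (k + l + 2 * n) (s + t)" for a
      by (rule no_depth) (use that in blast)
  qed (simp_all only: part1 weight deformation depth extends_rankin_cohen_exists[OF d_derivation])
qed

end
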